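(* Let $\Omega\subset\mathbb{R}^d$ with $d>1$ be a convex body or a finite union of convex bodies, and let $f:\Omega\to\mathbb{R}$ belong to $\mathcal{C}^k(\Omega)$. Construct a set of equispaced sample points $\boldsymbol{X}=\{\mathbf{x}_i\}_{1\le i\le M}\subset\Omega$ by an equispaced discretization of $\Omega$ dense enough that the mesh condition given in the context is satisfied, with $M=O(N^2)$. Let $\mathcal{L}(f)\in\mathcal{P}^T_{d,n}$ be the least-squares approximation of $f$ obtained by applying the multivariate Vandermonde with Arnoldi (V+A) algorithm with the sample points $\boldsymbol{X}$. Then $$\|f-\mathcal{L}(f)\|_\Omega\le\big(1+O(N)\big)\,O(n^{-k})=O(n^{d-k})=O\big(N^{1-\frac kd}\big),$$ where $n$ is the order of the indices (the total degree) and $N=\dim\mathcal{P}^T_{d,n}$ is the total degrees of freedom.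
   Context: A convex body is a convex compact subset of $\mathbb{R}^d$ with non-empty interior. $\omega(\Omega)$ denotes the minimal distance between two parallel supporting hyperplanes for $\Omega$, and $\mathcal{M}(\Omega)=\frac{4}{\omega(\Omega)}$ for the total degree space. For bounded $g:\Omega\to\mathbb{R}$, $\|g\|_\Omega=\sup_{\mathbf{x}\in\Omega}|g(\mathbf{x})|$. $\mathcal{C}^k(\Omega)$ is the set of functions $f$ with $D^\gamma f\in\mathcal{C}(\Omega)$ for all multi-indices $\gamma$ with $\|\gamma\|_1\le k$ (continuous derivatives up to total order $k$). $\mathcal{P}^T_{d,n}$ is the space of real polynomials in $d$ variables spanned by the monomials $x_{(1)}^{\alpha_1}\cdots x_{(d)}^{\alpha_d}$ with $\sum_{r=1}^d\alpha_r\le n$; $N=\binom{n+d}{n}$. Equispaced discretization of a compact set $\Omega\subset\mathbb{R}^d$: take a bounding box (hypercube) $\Omega_{cube}\supset\Omega$, define an equispaced grid of points on $\Omega_{cube}$, and restrict this grid to the points contained in $\Omega$. Mesh condition (for a fixed constant $0<c\le\frac{1}{2\sqrt d}$): for all $\mathbf{x}\in\Omega$, $\inf_{\mathbf{x}_i\in\boldsymbol{X}}\|\mathbf{x}_i-\mathbf{x}\|_\infty\le\frac{c}{\mathcal{M}(\Omega)\,n^2}$. In exact arithmetic the V+A algorithm (least squares in a basis of $\mathcal{P}^T_{d,n}$ that is orthonormalized by a Gram–Schmidt process with respect to the discrete measure on $\boldsymbol{X}$) computes $\mathcal{L}(f)=\operatorname{argmin}_{p\in\mathcal{P}^T_{d,n}}\sum_{i=1}^M|f(\mathbf{x}_i)-p(\mathbf{x}_i)|^2$.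 *)

theory Defs
  imports "HOL-Analysis.Analysis" "HOL-Library.Landau_Symbols"
begin

definition convex_body :: "'a::euclidean_space set \<Rightarrow> bool" where
  "convex_body \<Omega> \<longleftrightarrow> convex \<Omega> \<and> compact \<Omega> \<and> interior \<Omega> \<noteq> {}"

definition finite_union_of_convex_bodies :: "'a::euclidean_space set \<Rightarrow> bool" where
  "finite_union_of_convex_bodies \<Omega> \<longleftrightarrow>
     (\<exists>F. finite F \<and> F \<noteq> {} \<and> (\<forall>B\<in>F. convex_body B) \<and> \<Omega> = \<Union>F)"

definition supporting_hyperplane :: "'a::euclidean_space set \<Rightarrow> 'a set \<Rightarrow> bool" where
  "supporting_hyperplane \<Omega> H \<longleftrightarrow>
     (\<exists>u a. u \<noteq> 0 \<and> H = {y. u \<bullet> y = a} \<and> (\<forall>x\<in>\<Omega>. u \<bullet> x \<le> a) \<and> H \<inter> \<Omega> \<noteq> {})"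

text \<open>The minimal distance between two distinct parallel supporting hyperplanes. The definition
  is used unchanged for sets that are not convex.\<close>
definition minimal_width :: "'a::euclidean_space set \<Rightarrow> real" where
  "minimal_width \<Omega> = Inf {setdist H1 H2 | H1 H2. supporting_hyperplane \<Omega> H1 \<and>
     supporting_hyperplane \<Omega> H2 \<and> affine_parallel H1 H2 \<and> H1 \<noteq> H2}"

definition markov_factor :: "'a::euclidean_space set \<Rightarrow> real" where
  "markov_factor \<Omega> = 4 / minimal_width \<Omega>"

definition sup_norm_on :: "'a set \<Rightarrow> ('a \<Rightarrow> real) \<Rightarrow> real" where
  "sup_norm_on \<Omega> g = (SUP x\<in>\<Omega>. \<bar>g x\<bar>)"

text \<open>Multi-indices are functions \<open>\<gamma> :: 'd \<Rightarrow> nat\<close> of order \<open>sum \<gamma> UNIV\<close>, and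
  \<open>D \<gamma>\<close> is the partial derivative of order \<open>\<gamma>\<close>. As \<open>\<Omega>\<close> is closed, differentiability up to
  its boundary is meant in the usual sense that \<open>f\<close> is the restriction to \<open>\<Omega>\<close> of a function
  \<open>D 0\<close> that is \<open>k\<close> times continuously differentiable on an open neighbourhood of \<open>\<Omega>\<close>.\<close>
definition continuously_differentiable_to_order ::
    "nat \<Rightarrow> (real ^ 'd::finite) set \<Rightarrow> (real ^ 'd \<Rightarrow> real) \<Rightarrow> bool" where
  "continuously_differentiable_to_order k \<Omega> f \<longleftrightarrow>
     (\<exists>U (D :: ('d \<Rightarrow> nat) \<Rightarrow> real ^ 'd \<Rightarrow> real).
        open U \<and> \<Omega> \<subseteq> U \<and> (\<forall>x\<in>\<Omega>. D (\<lambda>_. 0) x = f x) \<and>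
        (\<forall>\<gamma>. sum \<gamma> UNIV \<le> k \<longrightarrow> continuous_on U (D \<gamma>)) \<and>
        (\<forall>\<gamma> i. sum \<gamma> UNIV < k \<longrightarrow>
           (\<forall>x\<in>U. ((\<lambda>t. D \<gamma> (x + t *\<^sub>R axis i 1))
              has_real_derivative D (\<gamma>(i := Suc (\<gamma> i))) x) (at 0))))"

definition total_degree_polys :: "nat \<Rightarrow> (real ^ 'd::finite \<Rightarrow> real) set" where
  "total_degree_polys n =
     {p. \<exists>c :: ('d \<Rightarrow> nat) \<Rightarrow> real.
           p = (\<lambda>x. \<Sum>\<alpha> | sum \<alpha> UNIV \<le> n. c \<alpha> * (\<Prod>r\<in>UNIV. (x $ r) ^ \<alpha> r))}"

definition total_degree_dim :: "nat \<Rightarrow> nat \<Rightarrow> nat" where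
  "total_degree_dim d n = (n + d) choose n"

text \<open>The bounding hypercube has lower corner \<open>a\<close> and side \<open>s\<close>; each side is divided into
  \<open>m\<close> equal parts, giving \<open>m + 1\<close> grid points per direction, endpoints included.\<close>
definition equispaced_discretization ::
    "(real ^ 'd::finite) set \<Rightarrow> (real ^ 'd) set \<Rightarrow> bool" where
  "equispaced_discretization \<Omega> X \<longleftrightarrow>
     (\<exists>(a :: real ^ 'd) s m. 0 < s \<and> 0 < m \<and> \<Omega> \<subseteq> cbox a (\<chi> i. a $ i + s) \<and>
        X = {x \<in> \<Omega>. \<exists>j :: 'd \<Rightarrow> nat. (\<forall>i. j i \<le> m) \<and>
               x = (\<chi> i. a $ i + real (j i) * (s / real m))})"

text \<open>Nonemptiness of \<open>X\<close> is required explicitly because the infimum over the empty set is not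
  infinite in type \<^typ>\<open>real\<close>.\<close>
definition mesh_condition ::
    "real \<Rightarrow> nat \<Rightarrow> (real ^ 'd::finite) set \<Rightarrow> (real ^ 'd) set \<Rightarrow> bool" where
  "mesh_condition c n \<Omega> X \<longleftrightarrow> X \<noteq> {} \<and>
     (\<forall>x\<in>\<Omega>. (INF y\<in>X. infnorm (y - x)) \<le> c / (markov_factor \<Omega> * (real n)\<^sup>2))"

text \<open>What Vandermonde with Arnoldi computes in exact arithmetic.\<close>
definition least_squares_approx ::
    "nat \<Rightarrow> (real ^ 'd::finite) set \<Rightarrow> (real ^ 'd \<Rightarrow> real) \<Rightarrow> (real ^ 'd \<Rightarrow> real) \<Rightarrow> bool" where
  "least_squares_approx n X f p \<longleftrightarrow>
     is_arg_min (\<lambda>q. \<Sum>x\<in>X. \<bar>f x - q x\<bar>\<^sup>2) (\<lambda>q. q \<in> total_degree_polys n) p"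

end

theory Submission
  imports Defs "HOL-Complex_Analysis.Conformal_Mappings" "HOL-Computational_Algebra.Polynomial"
begin

text \<open>The error splits into a best approximation error and a stability factor.

  Best approximation: in each coordinate, interpolate at Chebyshev nodes and damp with a kernel
  concentrated at the scale \<open>1 / n\<close>. The result reproduces polynomials of low degree and is so
  localized that \<open>f\<close> may be cut off outside a neighbourhood of \<open>\<Omega>\<close>. The tensor product of
  these operators has error \<open>O(n powr (- k))\<close>.

  Stability: the grid has spacing \<open>O(n powr (- 2))\<close>, but for a union of bodies the constant is
  governed by the width of the convex hull, so it may be too large for Markov's inequality on the
  single bodies. For an arbitrary constant, the maximum over a convex body is still at most a
  constant times the maximum over its grid points: shrink the body in finitely many steps of relative
  size \<open>O(n powr (- 2))\<close>. The maxima lose only a bounded factor in total, hence some step loses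
  little, and there Bernstein's inequality along segments pointing into the body controls the
  distance to the nearest grid point. Minimality of the sum of squares then gives the factor
  \<open>sqrt (card X) = O(N)\<close>.\<close>

section \<open>Growth of polynomials outside an interval\<close>

text \<open>Shrinking a body by a relative amount t costs a polynomial of degree n a factor exp(O(n
  sqrt t)). With N = A^2 steps of relative size (A / n)^2 the total cost is at most exp(3 N), so
  some step costs at most exp 3, whatever A is. With the margin left by one step, Bernstein's
  inequality bounds the change over a relative distance C / n^2 by O(C / A) times the maximum. Hence
  a large A beats every mesh constant C. A single step would not do: its cost grows exponentially in
  A. The approximation has another obstacle: f is smooth only near \<Omega>, which need not be
  convex, while tensor product nodes fill a box. Setting f to 0 away from \<Omega> creates a jump,
  which undamped Chebyshev interpolation would carry back to \<Omega>. The weight (1 + n |x - y|)^k,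
  kept in the bound of the interpolation operator, pays both for Taylor remainders near \<Omega> and
  for the jump at a fixed distance.\<close>

lemma poly_map_of_real: "poly (map_poly of_real p) (of_real x) = complex_of_real (poly p x)"
  by (induction p) (auto simp: map_poly_pCons)

text \<open>For w = exp(i z), multiplication by w^n cancels the pole of p((w + 1 / w) / 2) at 0, and
  on the unit circle the modulus is that of p(cos t). The maximum principle on the disc settles Im z
  \<ge> 0; the other half plane follows because cos is even.\<close>

lemma bernstein_walsh:
  fixes p :: "real poly" and z :: complex
  assumes deg: "degree p \<le> n" and V: "\<And>x. \<lbrakk>-1 \<le> x; x \<le> 1\<rbrakk> \<Longrightarrow> \<bar>poly p x\<bar> \<le> V"
  shows "norm (poly (map_poly of_real p) (cos z)) \<le> V * exp (real n * \<bar>Im z\<bar>)"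
proof -
  let ?P = "map_poly complex_of_real p"
  have P: "poly ?P x = (\<Sum>i\<le>n. of_real (coeff p i) * x ^ i)" for x
  proof -
    have "degree ?P \<le> n" using deg by (simp add: degree_map_poly)
    then have "(\<Sum>i\<le>degree ?P. coeff ?P i * x ^ i) = (\<Sum>i\<le>n. coeff ?P i * x ^ i)"
      by (intro sum.mono_neutral_left) (simp_all add: coeff_eq_0)
    then show ?thesis by (simp add: poly_altdef coeff_map_poly)
  qed
  \<comment> \<open>The factor w^n is distributed over the powers, so that no division by w is left
    and \<open>G\<close> is entire.\<close>
  define G where "G = (\<lambda>w. \<Sum>i\<le>n. of_real (coeff p i) * (w ^ (n - i) * ((w\<^sup>2 + 1) / 2) ^ i) :: complex)"
  have G: "G w = w ^ n * poly ?P ((w + 1 / w) / 2)" if "w \<noteq> 0" for w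
  proof -
    have "w ^ (n - i) * ((w\<^sup>2 + 1) / 2) ^ i = w ^ n * ((w + 1 / w) / 2) ^ i" if "i \<le> n" for i
    proof -
      have "(w\<^sup>2 + 1) / 2 = w * ((w + 1 / w) / 2)" using \<open>w \<noteq> 0\<close> by (simp add: field_simps power2_eq_square)
      then have "w ^ (n - i) * ((w\<^sup>2 + 1) / 2) ^ i = (w ^ (n - i) * w ^ i) * ((w + 1 / w) / 2) ^ i"
        by (metis mult.assoc power_mult_distrib)
      then show ?thesis using that by (simp flip: power_add)
    qed
    then show ?thesis unfolding G_def P sum_distrib_left by (intro sum.cong) auto
  qed
  have circle: "norm (G w) \<le> V" if "norm w = 1" for w
  proof -
    define t where "t = Arg w"
    have t: "w = cis t" using rcis_cmod_Arg[of w] that by (simp add: rcis_def t_def)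
    have "w + 1 / w = of_real (2 * cos t)"
      by (simp add: t complex_eq_iff cis_inverse flip: inverse_eq_divide)
    then have "(w + 1 / w) / 2 = of_real (cos t)" by simp
    moreover have "w \<noteq> 0" using that by auto
    ultimately have "G w = w ^ n * of_real (poly p (cos t))"
      using G[of w] that by (auto simp flip: poly_map_of_real)
    then show ?thesis using V[of "cos t"] that by (simp add: norm_mult norm_power)
  qed
  have disc: "norm (G w) \<le> V" if "norm w \<le> 1" for w
  proof (rule maximum_modulus_frontier[where S = "cball 0 1" and f = G])
    show "G holomorphic_on interior (cball 0 1)" unfolding G_def by (intro holomorphic_intros) auto
    show "continuous_on (closure (cball 0 1)) G" unfolding G_def by (intro continuous_intros) auto
  qed (use that circle in auto)
  have main: "norm (poly ?P (cos z)) \<le> V * exp (real n * \<bar>Im z\<bar>)" if "Im z \<ge> 0" for z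
  proof -
    define w where "w = exp (\<i> * z)"
    have w0: "w \<noteq> 0" and nw: "norm w = exp (- Im z)" by (auto simp: w_def)
    have c: "cos z = (w + 1 / w) / 2" by (simp add: w_def cos_exp_eq exp_minus field_simps)
    have "norm w ^ n * norm (poly ?P (cos z)) \<le> V"
      using disc[of w] G[OF w0] that by (simp add: nw c norm_mult norm_power)
    then have "norm (poly ?P (cos z)) \<le> V / exp (- Im z) ^ n" by (simp add: nw field_simps)
    also have "\<dots> = V * exp (real n * \<bar>Im z\<bar>)"
      using that by (simp add: exp_minus field_simps flip: exp_of_nat_mult)
    finally show ?thesis .
  qed
  show ?thesis using main[of z] main[of "- z"] by (cases "Im z \<ge> 0") auto
qed

text \<open>In the parametrization by cos, the point -t has imaginary part 2 u with sinh u = sqrt t.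
  An overshoot of order n^(-2) therefore costs only a constant factor.\<close>

lemma poly_growth_outside:
  fixes g :: "real poly"
  assumes deg: "degree g \<le> n" and V: "\<And>x. \<lbrakk>0 \<le> x; x \<le> 1\<rbrakk> \<Longrightarrow> \<bar>poly g x\<bar> \<le> V"
    and t: "t \<ge> 0"
  shows "\<bar>poly g (- t)\<bar> \<le> V * exp (2 * real n * sqrt t)"
proof -
  \<comment> \<open>The affine change reverses the orientation: [-1, 1] covers [0, 1], and 1 + 2 t
    goes to -t.\<close>
  define p where "p = g \<circ>\<^sub>p [:1/2, -1/2:]"
  have p: "poly p x = poly g ((1 - x) / 2)" for x by (simp add: p_def poly_pcompose field_simps)
  have dp: "degree p \<le> n" using deg by (simp add: p_def degree_pcompose)
  define u where "u = arsinh (sqrt t)"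
  have u: "sinh u = sqrt t" by (simp add: u_def)
  have u0: "0 \<le> u" using u t by (metis real_sqrt_ge_zero sinh_real_nonneg_iff)
  have "u \<le> sqrt t" unfolding u[symmetric] using real_le_x_sinh[OF u0] by (simp add: sinh_field_def exp_minus)
  have "cosh (2 * u) = 1 + 2 * t" using u t by (simp add: cosh_double cosh_square_eq)
  moreover have "cosh (complex_of_real v) = of_real (cosh v)" for v
    by (simp add: cosh_def scaleR_conv_of_real flip: exp_of_real)
  ultimately have c: "cos (\<i> * of_real (2 * u)) = complex_of_real (1 + 2 * t)"
    by (metis cosh_conv_cos)
  have "norm (poly (map_poly of_real p) (cos (\<i> * of_real (2 * u)))) \<le> V * exp (real n * \<bar>Im (\<i> * of_real (2 * u))\<bar>)"
    by (rule bernstein_walsh[OF dp]) (auto simp: p intro!: V)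
  then have "norm (complex_of_real (poly p (1 + 2 * t))) \<le> V * exp (real n * (2 * u))"
    unfolding c poly_map_of_real using u0 by simp
  then have "\<bar>poly g (- t)\<bar> \<le> V * exp (real n * (2 * u))" by (simp add: p)
  also have "\<dots> \<le> V * exp (2 * real n * sqrt t)"
    using \<open>u \<le> sqrt t\<close> V[of 0] by (intro mult_left_mono) (auto intro: mult_left_mono simp: mult.commute[of u])
  finally show ?thesis .
qed

section \<open>Bernstein's inequality, globally and next to an endpoint\<close>

lemma bernstein_trig:
  fixes p :: "real poly"
  assumes deg: "degree p \<le> n" and n: "n > 0" and V: "\<And>x. \<lbrakk>-1 \<le> x; x \<le> 1\<rbrakk> \<Longrightarrow> \<bar>poly p x\<bar> \<le> V"
  shows "\<bar>poly p (cos a) - poly p (cos b)\<bar> \<le> 3 * real n * V * \<bar>a - b\<bar>"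
proof -
  define F where "F = (\<lambda>z. poly (map_poly complex_of_real p) (cos z))"
  have hol: "F holomorphic_on A" for A unfolding F_def by (intro holomorphic_intros)
  have F: "F (of_real x) = of_real (poly p (cos x))" for x
    unfolding F_def cos_of_real poly_map_of_real ..
  have D: "norm (deriv F (of_real x)) \<le> 3 * real n * V" for x :: real
  proof -
    have V0: "V \<ge> 0" using V[of 0] by simp
    \<comment> \<open>Cauchy's estimate on a circle of radius 1 / n: imaginary parts there are at
      most 1 / n, so \<open>bernstein_walsh\<close> bounds \<open>F\<close> by V e, and e \<le> 3
      gives the constant.\<close>
    have "norm ((deriv ^^ 1) F (of_real x)) \<le> fact 1 * (V * exp 1) / (1 / real n) ^ 1"
    proof (rule Cauchy_inequality)
      fix w :: complex assume "norm (of_real x - w) = 1 / real n"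
      then have "\<bar>Im w\<bar> \<le> 1 / real n" using abs_Im_le_cmod[of "of_real x - w"] by simp
      then have "real n * \<bar>Im w\<bar> \<le> 1" using n by (simp add: field_simps)
      then have "V * exp (real n * \<bar>Im w\<bar>) \<le> V * exp 1" using V0 by (intro mult_left_mono) auto
      then show "norm (F w) \<le> V * exp 1"
        unfolding F_def using bernstein_walsh[OF deg V, of w] by linarith
    qed (use n hol holomorphic_on_imp_continuous_on in auto)
    also have "\<dots> = V * real n * exp 1" by simp
    also have "\<dots> \<le> V * real n * 3" using V0 exp_le by (intro mult_left_mono) auto
    finally show ?thesis by (simp add: mult_ac)
  qed
  have "norm (F (of_real a) - F (of_real b)) \<le> 3 * real n * V * norm (complex_of_real a - of_real b)"
  proof (rule field_differentiable_bound[where S = "\<real>" and f' = "deriv F"])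
    show "(F has_field_derivative deriv F z) (at z within \<real>)" for z
      using hol[of UNIV] by (metis UNIV_I holomorphic_derivI has_field_derivative_at_within open_UNIV)
    show "norm (deriv F z) \<le> 3 * real n * V" if "z \<in> \<real>" for z using that D by (auto elim: Reals_cases)
  qed (auto simp: convex_Reals)
  then show ?thesis unfolding F by (simp flip: of_real_diff)
qed

text \<open>A margin \<eta> beyond 0 replaces the factor n^2 of Markov's inequality at an endpoint
  by n / sqrt \<eta>. The constant 12 is 3 from \<open>bernstein_trig\<close> times 4 from the
  Lipschitz estimate of the angle.\<close>

lemma bernstein_endpoint:
  fixes g :: "real poly"
  assumes deg: "degree g \<le> n" and n: "n > 0" and V: "\<And>x. \<lbrakk>- \<eta> \<le> x; x \<le> 1\<rbrakk> \<Longrightarrow> \<bar>poly g x\<bar> \<le> V"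
    and \<eta>: "0 < \<eta>" "\<eta> \<le> 1" and s: "0 \<le> s" "s \<le> 1/2"
  shows "\<bar>poly g s - poly g 0\<bar> \<le> 12 * real n * V * s / sqrt \<eta>"
proof -
  define p where "p = g \<circ>\<^sub>p [:(1 - \<eta>) / 2, - (1 + \<eta>) / 2:]"
  have p: "poly p x = poly g ((1 - \<eta>) / 2 - (1 + \<eta>) / 2 * x)" for x
    by (simp add: p_def poly_pcompose field_simps)
  have dp: "degree p \<le> n" using deg \<eta> by (simp add: p_def degree_pcompose)
  have Vp: "\<bar>poly p x\<bar> \<le> V" if x: "-1 \<le> x" "x \<le> 1" for x
  proof -
    have "(1 + \<eta>) / 2 * x \<le> (1 + \<eta>) / 2 * 1" "(1 + \<eta>) / 2 * (-1) \<le> (1 + \<eta>) / 2 * x"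
      using x \<eta> by (intro mult_left_mono; simp)+
    then show ?thesis unfolding p by (intro V) (simp_all add: field_simps)
  qed
  have V0: "V \<ge> 0" using V[of 0] \<eta> by auto
  \<comment> \<open>\<open>S x\<close> is the sine of half the angle at which the rescaled cosine
    takes the value x.\<close>
  define S where "S = (\<lambda>x. sqrt ((\<eta> + x) / (1 + \<eta>)))"
  have S: "0 \<le> S x" "S x < 1" "S x ^ 2 = (\<eta> + x) / (1 + \<eta>)" if "0 \<le> x" "x \<le> 1/2" for x
    using that \<eta> by (auto simp: S_def real_sqrt_lt_1_iff)
  define \<theta> where "\<theta> = (\<lambda>x. 2 * arcsin (S x))"
  have c: "poly p (cos (\<theta> x)) = poly g x" if "0 \<le> x" "x \<le> 1/2" for x
  proof -
    have "cos (\<theta> x) = 1 - 2 * S x ^ 2"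
      unfolding \<theta>_def cos_double_sin using S[OF that] by simp
    also have "\<dots> = 1 - 2 * ((\<eta> + x) / (1 + \<eta>))" using S[OF that] by simp
    finally have "(1 - \<eta>) / 2 - (1 + \<eta>) / 2 * cos (\<theta> x) = x" using \<eta> by (simp add: field_simps)
    then show ?thesis unfolding p by simp
  qed
  have S0s: "S 0 \<le> S s" unfolding S_def using s \<eta> by (simp add: divide_right_mono)
  have d1: "\<theta> s - \<theta> 0 \<le> 4 * (S s - S 0)"
  proof -
    define a b where "a = arcsin (S 0)" and "b = arcsin (S s)"
    have ab: "0 \<le> a" "a \<le> b" "b \<le> pi / 2" unfolding a_def b_def
      using S[of 0] S[of s] s S0s arcsin_ubound[of "S s"] by (auto intro!: arcsin_le_arcsin arcsin_nonneg)
    have cb: "cos b \<ge> 1/2"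
    proof -
      \<comment> \<open>The extreme case is \<eta> = 1, s = 1/2. The bound keeps the half angle away
        from pi / 2, near which arcsin is not Lipschitz.\<close>
      have "S s ^ 2 \<le> 3/4" unfolding S(3)[OF s] using s \<eta> by (simp add: divide_le_eq)
      then have "(1/2)^2 \<le> 1 - S s ^ 2" by (simp add: power2_eq_square)
      then show ?thesis unfolding b_def using S(1,2)[of s] s
        real_le_rsqrt[of "1/2" "1 - S s ^ 2"] by (subst cos_arcsin) auto
    qed
    have "(b - a) / 2 \<le> sin b - sin a"
    proof (cases "a = b")
      case False
      then obtain z where z: "a < z" "z < b" "sin b - sin a = (b - a) * cos z"
        using MVT2[of a b sin cos] ab by (auto intro!: derivative_eq_intros)
      have "cos b \<le> cos z" using z ab by (intro cos_monotone_0_pi_le) auto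
      then have "(b - a) * (1/2) \<le> (b - a) * cos z" using cb ab by (intro mult_left_mono) auto
      then show ?thesis using z by simp
    qed auto
    moreover have "sin b = S s" "sin a = S 0" unfolding a_def b_def using S[of 0] S[of s] s by auto
    ultimately show ?thesis unfolding \<theta>_def a_def b_def by simp
  qed
  have d2: "S s - S 0 \<le> s / sqrt \<eta>"
  proof -
    have "S x = sqrt (\<eta> + x) / sqrt (1 + \<eta>)" for x by (simp add: S_def real_sqrt_divide)
    then have "S s - S 0 = (sqrt (\<eta> + s) - sqrt \<eta>) / sqrt (1 + \<eta>)" by (simp add: diff_divide_distrib)
    also have "\<dots> \<le> (sqrt (\<eta> + s) - sqrt \<eta>) / 1" using \<eta> s by (intro divide_left_mono) auto
    also have "\<dots> \<le> s / sqrt \<eta>"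
    proof -
      have "(sqrt (\<eta> + s) - sqrt \<eta>) * sqrt \<eta> \<le> (sqrt (\<eta> + s) - sqrt \<eta>) * (sqrt (\<eta> + s) + sqrt \<eta>)"
        using \<eta> s by (intro mult_left_mono) auto
      also have "\<dots> = s" using \<eta> s by (simp add: algebra_simps)
      finally show ?thesis using \<eta> by (simp add: field_simps)
    qed
    finally show ?thesis .
  qed
  have "\<theta> 0 \<le> \<theta> s" unfolding \<theta>_def using S0s S(1,2)[of s] S(1,2)[of 0] s
    by (intro mult_left_mono arcsin_le_arcsin) linarith+
  then have d: "\<bar>\<theta> s - \<theta> 0\<bar> \<le> 4 * (s / sqrt \<eta>)"
    using d1 mult_left_mono[OF d2, of 4] by simp
  have "\<bar>poly p (cos (\<theta> s)) - poly p (cos (\<theta> 0))\<bar> \<le> 3 * real n * V * \<bar>\<theta> s - \<theta> 0\<bar>"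
    by (rule bernstein_trig[OF dp n Vp])
  also have "\<dots> \<le> 3 * real n * V * (4 * (s / sqrt \<eta>))"
    using V0 d by (intro mult_left_mono) auto
  finally show ?thesis using c[of s] c[of 0] s by simp
qed

section \<open>Chebyshev polynomials and interpolation\<close>

fun chebyshev :: "nat \<Rightarrow> real poly" where
  "chebyshev 0 = 1"
| "chebyshev (Suc 0) = [:0, 1:]"
| "chebyshev (Suc (Suc n)) = [:0, 2:] * chebyshev (Suc n) - chebyshev n"

lemma degree_chebyshev: "degree (chebyshev n) \<le> n"
proof (induction n rule: chebyshev.induct)
  case (3 n)
  have "degree ([:0, 2:] * chebyshev (Suc n)) \<le> 1 + Suc n"
    using degree_mult_le[of "[:0, 2:]" "chebyshev (Suc n)"] 3(1) by simp
  then show ?case using 3(2) by (auto intro!: degree_diff_le)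
qed auto

lemma poly_chebyshev_cos: "poly (chebyshev n) (cos t) = cos (real n * t)"
proof (induction n rule: chebyshev.induct)
  case (3 n)
  have "cos (real (Suc (Suc n)) * t) + cos (real n * t) = 2 * cos t * cos (real (Suc n) * t)"
    using cos_times_cos[of "real (Suc n) * t" t] by (simp add: algebra_simps)
  with 3 show ?case by (simp add: algebra_simps)
qed auto

text \<open>\<open>sine_quotient v\<close> expresses \<open>sin ((2 * v + 1) * t) / sin t\<close> as a polynomial in \<open>sin t\<close>.\<close>
fun sine_quotient :: "nat \<Rightarrow> real poly" where
  "sine_quotient 0 = 1"
| "sine_quotient (Suc 0) = [:3, 0, -4:]"
| "sine_quotient (Suc (Suc v)) = [:2, 0, -4:] * sine_quotient (Suc v) - sine_quotient v"

lemma degree_sine_quotient: "degree (sine_quotient v) \<le> 2 * v"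
proof (induction v rule: sine_quotient.induct)
  case (3 n)
  have "degree ([:2, 0, -4:] * sine_quotient (Suc n)) \<le> 2 + 2 * Suc n"
    using degree_mult_le[of "[:2, 0, -4:]" "sine_quotient (Suc n)"] 3(1) by simp
  then show ?case using 3(2) by (auto intro!: degree_diff_le)
qed auto

lemma poly_sine_quotient_0: "poly (sine_quotient v) 0 = 2 * real v + 1"
  by (induction v rule: sine_quotient.induct) auto

lemma poly_sine_quotient_sin: "sin t * poly (sine_quotient v) (sin t) = sin ((2 * real v + 1) * t)"
proof (induction v rule: sine_quotient.induct)
  case 2
  have "sin (3 * t) = sin (2 * t + t)" by simp
  also have "\<dots> = 3 * sin t - 4 * sin t ^ 3"
    unfolding sin_add sin_double cos_double_sin
    by (simp add: algebra_simps power2_eq_square power3_eq_cube) (simp add: cos_squared_eq flip: power2_eq_square power3_eq_cube mult.assoc, simp add: algebra_simps power2_eq_square)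
  finally show ?case by (simp add: algebra_simps power3_eq_cube)
next
  case (3 v)
  have "sin ((2 * real (Suc (Suc v)) + 1) * t) + sin ((2 * real v + 1) * t) =
      2 * cos (2 * t) * sin ((2 * real (Suc v) + 1) * t)"
    using sin_times_cos[of "(2 * real (Suc v) + 1) * t" "2 * t"] by (simp add: algebra_simps)
  also have "2 * cos (2 * t) = 2 - 4 * sin t ^ 2" by (simp add: cos_double_sin)
  finally have "sin ((2 * real (Suc (Suc v)) + 1) * t) =
     (2 - 4 * sin t ^ 2) * (sin t * poly (sine_quotient (Suc v)) (sin t)) - sin t * poly (sine_quotient v) (sin t)"
    using 3 by simp
  then show ?case by (simp add: algebra_simps power2_eq_square)
qed auto

lemma abs_sin_mult_le: "\<bar>sin (real n * t)\<bar> \<le> real n * \<bar>sin t\<bar>"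
proof (induction n)
  case (Suc n)
  have "sin (real (Suc n) * t) = sin (real n * t) * cos t + cos (real n * t) * sin t"
    by (simp add: distrib_right sin_add add.commute)
  also have "\<bar>\<dots>\<bar> \<le> \<bar>sin (real n * t)\<bar> * \<bar>cos t\<bar> + \<bar>cos (real n * t)\<bar> * \<bar>sin t\<bar>"
    by (metis abs_mult abs_triangle_ineq)
  also have "\<dots> \<le> \<bar>sin (real n * t)\<bar> * 1 + 1 * \<bar>sin t\<bar>"
    by (intro add_mono mult_left_mono mult_right_mono) auto
  finally show ?case using Suc by (simp add: algebra_simps)
qed auto

lemma sine_quotient_bounds:
  assumes "\<bar>x\<bar> \<le> 1"
  shows "\<bar>poly (sine_quotient v) x\<bar> \<le> 2 * real v + 1" "\<bar>x * poly (sine_quotient v) x\<bar> \<le> 1"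
proof -
  define t where "t = arcsin x"
  have t: "sin t = x" using assms by (simp add: t_def)
  have e: "x * poly (sine_quotient v) x = sin (real (2 * v + 1) * t)"
    using poly_sine_quotient_sin[of t v] by (simp add: t add.commute)
  then show "\<bar>x * poly (sine_quotient v) x\<bar> \<le> 1" by simp
  show "\<bar>poly (sine_quotient v) x\<bar> \<le> 2 * real v + 1"
  proof (cases "x = 0")
    case False
    have "\<bar>x\<bar> * \<bar>poly (sine_quotient v) x\<bar> \<le> \<bar>x\<bar> * (2 * real v + 1)"
      using abs_sin_mult_le[of "2 * v + 1" t] e by (simp add: t mult.commute add.commute flip: abs_mult)
    then show ?thesis using False by simp
  qed (simp add: poly_sine_quotient_0)
qed

section \<open>Discrete orthogonality and interpolation at the Chebyshev nodes\<close>

definition cheb_angle :: "nat \<Rightarrow> nat \<Rightarrow> real" where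
  "cheb_angle m j = (2 * real j + 1) * pi / (2 * real m)"

text \<open>The Lagrange basis at the zeros \<open>cos (cheb_angle m j)\<close> of the Chebyshev
  polynomial of degree m, written as a discrete cosine series and not as a product. In this form the
  uniform bound 2 is immediate.\<close>

definition cheb_lagrange :: "nat \<Rightarrow> nat \<Rightarrow> real poly" where
  "cheb_lagrange m j = smult (1 / real m)
     (1 + (\<Sum>l\<in>{1..<m}. smult (2 * cos (real l * cheb_angle m j)) (chebyshev l)))"

text \<open>Multiplying by 2 sin h turns cosines at odd multiples of h into a telescoping sum that
  ends in sin (s pi) = 0. The range of s makes sin h positive.\<close>

lemma sum_cos_cheb_angle:
  assumes "0 < s" "s < 2 * m"
  shows "(\<Sum>j<m. cos (real s * cheb_angle m j)) = 0"
proof -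
  define h where "h = real s * pi / (2 * real m)"
  have m: "m > 0" using assms by auto
  have "(\<Sum>j<m. 2 * (sin h * cos (real s * cheb_angle m j))) = (\<Sum>j<m. sin (2 * real (Suc j) * h) - sin (2 * real j * h))"
  proof (rule sum.cong)
    fix j
    have "real s * cheb_angle m j = (2 * real j + 1) * h" by (simp add: cheb_angle_def h_def)
    then show "2 * (sin h * cos (real s * cheb_angle m j)) = sin (2 * real (Suc j) * h) - sin (2 * real j * h)"
      using sin_times_cos[of h "(2 * real j + 1) * h"] sin_minus[of "2 * real j * h"] by (simp add: algebra_simps)
  qed simp
  also have "\<dots> = sin (2 * real m * h) - sin 0" by (subst sum_lessThan_telescope) simp
  also have "2 * real m * h = real s * pi" using m by (simp add: h_def)
  finally have "sin h * (\<Sum>j<m. cos (real s * cheb_angle m j)) = 0" by (simp add: sum_distrib_left[symmetric])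
  moreover have "sin h > 0"
  proof (rule sin_gt_zero)
    show "0 < h" using assms m by (simp add: h_def)
    have "real s * pi < (2 * real m) * pi" using assms by (intro mult_strict_right_mono) auto
    then show "h < pi" using m by (simp add: h_def field_simps)
  qed
  ultimately show ?thesis by simp
qed

text \<open>The product-to-sum formula leaves the frequencies |i - l| and i + l. Both are below 2 m,
  so their cosine sums vanish unless the frequency is 0.\<close>

lemma cheb_orthogonality:
  assumes "i < m" "l < m"
  shows "(\<Sum>j<m. cos (real i * cheb_angle m j) * cos (real l * cheb_angle m j)) =
    (if i = l then if i = 0 then real m else real m / 2 else 0)"
proof -
  define d where "d = (if i \<ge> l then i - l else l - i)"
  have d: "real i - real l = real d \<or> real i - real l = - real d" by (auto simp: d_def of_nat_diff)
  have "cos (real i * t) * cos (real l * t) = (cos (real d * t) + cos (real (i + l) * t)) / 2" for t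
  proof -
    have "cos (real i * t - real l * t) = cos (real d * t)"
      using d by (auto simp: left_diff_distrib[symmetric])
    then show ?thesis by (simp add: cos_times_cos distrib_right)
  qed
  note c = this
  have *: "(\<Sum>j<m. cos (real i * cheb_angle m j) * cos (real l * cheb_angle m j)) =
     ((\<Sum>j<m. cos (real d * cheb_angle m j)) + (\<Sum>j<m. cos (real (i + l) * cheb_angle m j))) / 2"
    by (simp only: c sum.distrib flip: sum_divide_distrib)
  show ?thesis
  proof (cases "i = l")
    case True
    then have "d = 0" by (simp add: d_def)
    then show ?thesis unfolding * using True sum_cos_cheb_angle[of "i + l" m] assms by (cases "i = 0") auto
  next
    case False
    then have "0 < d" "d < 2 * m" "0 < i + l" "i + l < 2 * m" using assms by (auto simp: d_def)
    then show ?thesis unfolding * using False by (simp add: sum_cos_cheb_angle del: of_nat_add)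
  qed
qed

text \<open>Multiplication by X respects the span because 2 X T_i = T_(i+1) + T_(i-1). The induction
  leaves m arbitrary, since the tail of the coefficient list has to be expanded with m - 1.\<close>

lemma chebyshev_expansion:
  assumes "degree q < m"
  shows "\<exists>a. q = (\<Sum>i<m. smult (a i) (chebyshev i))"
  using assms
proof (induction q arbitrary: m rule: pCons_induct)
  case 0
  show ?case by (intro exI[of _ "\<lambda>_. 0"]) simp
next
  case (pCons c q)
  define E where "E = {p. \<exists>a. p = (\<Sum>i<m. smult (a i) (chebyshev i))}"
  have add: "p + p' \<in> E" if "p \<in> E" "p' \<in> E" for p p'
  proof -
    obtain a a' where "p = (\<Sum>i<m. smult (a i) (chebyshev i))" "p' = (\<Sum>i<m. smult (a' i) (chebyshev i))"
      using \<open>p \<in> E\<close> \<open>p' \<in> E\<close> unfolding E_def by blast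
    then show ?thesis unfolding E_def
      by (auto intro!: exI[of _ "\<lambda>i. a i + a' i"] simp: smult_add_left sum.distrib)
  qed
  have scale: "smult c p \<in> E" if "p \<in> E" for c p
  proof -
    obtain a where "p = (\<Sum>i<m. smult (a i) (chebyshev i))" using \<open>p \<in> E\<close> unfolding E_def by blast
    then have "smult c p = (\<Sum>i<m. smult (c * a i) (chebyshev i))"
      by (intro poly_eqI) (simp add: coeff_sum sum_distrib_left mult.assoc)
    then show ?thesis unfolding E_def by (intro CollectI exI)
  qed
  have base: "chebyshev l \<in> E" if "l < m" for l
  proof -
    have "(\<Sum>i<m. smult (if i = l then 1 else 0) (chebyshev i)) = chebyshev l"
      using that by (simp add: if_distrib[of "\<lambda>a. smult a _"] cong: if_cong)
    then show ?thesis unfolding E_def by (auto intro!: exI[of _ "\<lambda>i. if i = l then 1 else 0"])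
  qed
  have sum: "(\<Sum>i\<in>I. p i) \<in> E" if "finite I" "\<And>i. i \<in> I \<Longrightarrow> p i \<in> E" for I and p :: "nat \<Rightarrow> real poly"
    using that
  proof (induction I)
    case empty
    show ?case using scale[OF base[of 0], of 0] pCons.prems by simp
  qed (auto intro: add)
  have const: "[:c:] \<in> E"
  proof -
    have "smult c (chebyshev 0) \<in> E" using pCons.prems by (intro scale base) auto
    then show ?thesis by (simp add: one_pCons)
  qed
  have "[:0, 1:] * q \<in> E"
  proof (cases "q = 0")
    case True
    then show ?thesis using scale[OF const, of 0] by simp
  next
    case False
    then have m: "degree q < m - 1" "m \<ge> 2" using pCons.prems by auto
    from pCons.IH[OF m(1)] obtain a where a: "q = (\<Sum>i<m - 1. smult (a i) (chebyshev i))" by blast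
    have "[:0, 1:] * chebyshev i \<in> E" if "i < m - 1" for i
    proof (cases i)
      case 0
      then show ?thesis using base[of 1] m by simp
    next
      case (Suc l)
      have "[:0, 1:] * chebyshev i = smult (1/2) (chebyshev (Suc i)) + smult (1/2) (chebyshev l)"
        unfolding Suc by (simp add: smult_diff_right)
      moreover have "Suc i < m" "l < m" using that Suc by auto
      then have "smult (1/2) (chebyshev (Suc i)) + smult (1/2) (chebyshev l) \<in> E"
        by (intro add scale base)
      ultimately show ?thesis by simp
    qed
    then show ?thesis unfolding a sum_distrib_left mult_smult_right by (intro sum scale) auto
  qed
  then have "pCons c q \<in> E" using add[OF const, of "[:0, 1:] * q"] by simp
  then show ?case by (simp add: E_def)
qed

lemma cheb_lagrange_interpolation:
  assumes "degree q < m"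
  shows "(\<Sum>j<m. poly (cheb_lagrange m j) x * poly q (cos (cheb_angle m j))) = poly q x"
proof -
  have base: "(\<Sum>j<m. poly (cheb_lagrange m j) x * cos (real i * cheb_angle m j)) = poly (chebyshev i) x"
    if i: "i < m" for i
  proof -
    let ?T = "\<lambda>l. poly (chebyshev l) x" and ?c = "\<lambda>l j. cos (real l * cheb_angle m j)"
    have "(\<Sum>j<m. poly (cheb_lagrange m j) x * ?c i j) =
       (1 / real m) * (\<Sum>j<m. ?c i j * ?c 0 j + (\<Sum>l\<in>{1..<m}. 2 * ?T l * (?c i j * ?c l j)))"
      by (simp add: cheb_lagrange_def poly_sum sum_distrib_left sum_distrib_right distrib_right distrib_left mult_ac)
    also have "\<dots> = (1 / real m) * ((\<Sum>j<m. ?c i j * ?c 0 j) + (\<Sum>l\<in>{1..<m}. 2 * ?T l * (\<Sum>j<m. ?c i j * ?c l j)))"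
      unfolding sum.distrib sum_distrib_left by (subst sum.swap) simp
    also have "(\<Sum>j<m. ?c i j * ?c 0 j) = (if i = 0 then real m else 0)"
      using cheb_orthogonality[OF i, of 0] i by auto
    also have "(\<Sum>l\<in>{1..<m}. 2 * ?T l * (\<Sum>j<m. ?c i j * ?c l j)) = (\<Sum>l\<in>{1..<m}. if l = i then ?T i * real m else 0)"
      using i by (intro sum.cong) (auto simp: cheb_orthogonality)
    also have "\<dots> = (if i = 0 then 0 else ?T i * real m)" using i by simp
    finally show ?thesis using i by auto
  qed
  obtain a where a: "q = (\<Sum>i<m. smult (a i) (chebyshev i))" using chebyshev_expansion[OF assms] by blast
  have "(\<Sum>j<m. poly (cheb_lagrange m j) x * poly q (cos (cheb_angle m j))) =
     (\<Sum>i<m. a i * (\<Sum>j<m. poly (cheb_lagrange m j) x * cos (real i * cheb_angle m j)))"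
    unfolding a poly_sum sum_distrib_left by (subst sum.swap) (simp add: poly_chebyshev_cos mult_ac)
  also have "\<dots> = poly q x" unfolding a poly_sum by (intro sum.cong) (auto simp: base)
  finally show ?thesis .
qed

lemma degree_cheb_lagrange: "degree (cheb_lagrange m j) \<le> m - 1"
  unfolding cheb_lagrange_def
  by (intro order_trans[OF degree_smult_le] degree_add_le degree_sum_le)
    (auto intro!: order_trans[OF degree_smult_le] order_trans[OF degree_chebyshev])

lemma abs_cheb_lagrange:
  assumes "\<bar>x\<bar> \<le> 1" "m > 0"
  shows "\<bar>poly (cheb_lagrange m j) x\<bar> \<le> 2"
proof -
  have x: "x = cos (arccos x)" using assms by simp
  have "\<bar>1 + (\<Sum>l\<in>{1..<m}. 2 * cos (real l * cheb_angle m j) * poly (chebyshev l) x)\<bar> \<le>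
     1 + (\<Sum>l\<in>{1..<m}. \<bar>2 * cos (real l * cheb_angle m j) * poly (chebyshev l) x\<bar>)"
    by (rule order_trans[OF abs_triangle_ineq]) (simp add: sum_abs)
  also have "\<dots> \<le> 1 + (\<Sum>l\<in>{1..<m}. 2)"
  proof (intro add_left_mono sum_mono)
    fix l
    have "\<bar>cos (real l * cheb_angle m j)\<bar> * \<bar>poly (chebyshev l) x\<bar> \<le> 1 * 1"
      using poly_chebyshev_cos[of l "arccos x"] x by (intro mult_mono) auto
    then show "\<bar>2 * cos (real l * cheb_angle m j) * poly (chebyshev l) x\<bar> \<le> 2" by (simp add: abs_mult)
  qed
  also have "\<dots> \<le> 2 * real m" using assms by (simp add: of_nat_diff)
  finally show ?thesis using assms
    by (simp add: cheb_lagrange_def poly_sum abs_mult field_simps)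
qed

section \<open>Summability over the nodes and separation of their angles\<close>

lemma sum_inverse_shifted_squares: "(\<Sum>j<m. 1 / (1 + (real j - \<tau>)\<^sup>2)) \<le> 2 * pi"
proof -
  \<comment> \<open>The shift by 1/2 makes each difference an integral over a unit interval centred
    at j - \<tau>. There 1 / (1 + x^2) is at least half its value at the centre, which the factor 2
    makes up for.\<close>
  define F where "F = (\<lambda>j. 2 * arctan (real j - \<tau> - 1/2))"
  have "(\<Sum>j<m. 1 / (1 + (real j - \<tau>)\<^sup>2)) \<le> (\<Sum>j<m. F (Suc j) - F j)"
  proof (rule sum_mono)
    fix j
    define t where "t = real j - \<tau>"
    obtain \<xi> where \<xi>: "t - 1/2 < \<xi>" "\<xi> < t + 1/2" "arctan (t + 1/2) - arctan (t - 1/2) = 1 / (1 + \<xi>\<^sup>2)"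
      using MVT2[of "t - 1/2" "t + 1/2" arctan "\<lambda>x. 1 / (1 + x\<^sup>2)"] DERIV_arctan
      by (auto simp: inverse_eq_divide)
    have "\<bar>\<xi> - t\<bar> \<le> 1/2" using \<xi>(1,2) by linarith
    then have "(\<xi> - t)\<^sup>2 \<le> (1/2)\<^sup>2" using power_mono[of "\<bar>\<xi> - t\<bar>" "1/2" 2] by simp
    moreover have "\<xi>\<^sup>2 \<le> 2 * t\<^sup>2 + 2 * (\<xi> - t)\<^sup>2"
      using zero_le_power2[of "\<xi> - 2 * t"] by (simp add: power2_eq_square algebra_simps)
    ultimately have "1 + \<xi>\<^sup>2 \<le> 2 * (1 + t\<^sup>2)" by (simp add: power2_eq_square)
    then have "1 / (1 + t\<^sup>2) \<le> 2 / (1 + \<xi>\<^sup>2)"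
      by (subst frac_le_eq) (auto simp: add_pos_nonneg divide_le_0_iff zero_le_mult_iff add_nonneg_eq_0_iff intro: add_nonneg_nonneg)
    moreover have "F (Suc j) - F j = 2 * (arctan (t + 1/2) - arctan (t - 1/2))"
      by (simp add: F_def t_def algebra_simps)
    ultimately show "1 / (1 + (real j - \<tau>)\<^sup>2) \<le> F (Suc j) - F j" using \<xi> by (simp add: t_def)
  qed
  also have "\<dots> = F m - F 0" by (rule sum_lessThan_telescope)
  also have "\<dots> \<le> 2 * pi"
    using arctan_ubound[of "real m - \<tau> - 1/2"] arctan_lbound[of "real 0 - \<tau> - 1/2"] by (simp add: F_def)
  finally show ?thesis .
qed

lemma sin_ge_half:
  assumes "0 \<le> u" "u \<le> pi / 2"
  shows "u / 2 \<le> sin u"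
proof -
  define v where "v = u / 2"
  have v: "0 \<le> v" "v \<le> pi / 4" "v < pi / 2" using assms pi_gt_zero unfolding v_def by linarith+
  have c: "cos v \<ge> sqrt 2 / 2" using cos_monotone_0_pi_le[of v "pi / 4"] v by (simp add: cos_45)
  have c0: "cos v > 0" using v by (intro cos_gt_zero_pi) auto
  have "v * cos v \<le> sin v"
  proof (cases "v = 0")
    case False
    then obtain z where z: "0 < z" "z < v" "sin v - sin 0 = (v - 0) * cos z"
      using MVT2[of 0 v sin cos] v by (auto intro!: derivative_eq_intros)
    have "cos v \<le> cos z" using z v by (intro cos_monotone_0_pi_le) auto
    then show ?thesis using z v by (simp add: mult_left_mono)
  qed auto
  have "(sqrt 2 / 2)\<^sup>2 \<le> (cos v)\<^sup>2" using c by (intro power_mono) auto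
  then have "1/2 \<le> (cos v)\<^sup>2" by (simp add: power_divide)
  then have "u * (1/2) \<le> u * (cos v)\<^sup>2" using assms by (intro mult_left_mono) auto
  also have "\<dots> = 2 * (v * cos v) * cos v" by (simp add: v_def power2_eq_square)
  also have "\<dots> \<le> 2 * sin v * cos v" using \<open>v * cos v \<le> sin v\<close> c0 by simp
  also have "\<dots> = sin u" using sin_double[of v] by (simp add: v_def)
  finally show ?thesis by simp
qed

text \<open>Only \<theta> has to be central; \<phi> may be the angle of any node. The mean of the
  two angles then lies in [pi / 6, 5 pi / 6], where the sine is at least 1/2. This is why the
  interpolation is first built for |x| \<le> 1/2 only.\<close>

lemma cos_separation:
  assumes "\<bar>cos \<theta>\<bar> \<le> 1/2" "0 \<le> \<theta>" "\<theta> \<le> pi" "0 \<le> \<phi>" "\<phi> \<le> pi"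
  shows "\<bar>\<theta> - \<phi>\<bar> \<le> 4 * \<bar>cos \<theta> - cos \<phi>\<bar>"
proof -
  have \<theta>: "pi / 3 \<le> \<theta>" "\<theta> \<le> 2 * pi / 3"
  proof -
    show "pi / 3 \<le> \<theta>"
    proof (rule ccontr)
      assume "\<not> pi / 3 \<le> \<theta>"
      then have "cos (pi / 3) < cos \<theta>" using assms by (intro cos_monotone_0_pi) auto
      then show False using assms by (simp add: cos_60)
    qed
    have "cos (2 * pi / 3) = - 1/2" using cos_120 by simp
    show "\<theta> \<le> 2 * pi / 3"
    proof (rule ccontr)
      assume "\<not> \<theta> \<le> 2 * pi / 3"
      then have "cos \<theta> < cos (2 * pi / 3)" using assms by (intro cos_monotone_0_pi) auto
      then show False using assms by (simp add: \<open>cos (2 * pi / 3) = - 1/2\<close>)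
    qed
  qed
  define a where "a = (\<theta> + \<phi>) / 2"
  have a: "pi / 6 \<le> a" "a \<le> 5 * pi / 6" using \<theta> assms by (auto simp: a_def)
  have "sin a \<ge> 1/2"
  proof (cases "a \<le> pi / 2")
    case True
    then show ?thesis using sin_monotone_2pi_le[of "pi / 6" a] a by (simp add: sin_30)
  next
    case False
    then show ?thesis using sin_monotone_2pi_le[of "pi / 6" "pi - a"] a by (simp add: sin_30)
  qed
  define b where "b = \<bar>\<theta> - \<phi>\<bar> / 2"
  have b: "0 \<le> b" "b \<le> pi / 2" using assms by (auto simp: b_def)
  have sb: "\<bar>sin ((\<phi> - \<theta>) / 2)\<bar> \<ge> b / 2"
  proof -
    have "sin ((\<phi> - \<theta>) / 2) = sin b \<or> sin ((\<phi> - \<theta>) / 2) = - sin b"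
    proof (cases "\<phi> \<le> \<theta>")
      case True
      then have "(\<phi> - \<theta>) / 2 = - b" by (simp add: b_def field_simps)
      then show ?thesis by (metis sin_minus)
    qed (simp add: b_def)
    then show ?thesis using sin_ge_half[OF b] b by auto
  qed
  have "(1/2) * (b / 2) \<le> \<bar>sin a\<bar> * \<bar>sin ((\<phi> - \<theta>) / 2)\<bar>"
    using \<open>sin a \<ge> 1/2\<close> sb b by (intro mult_mono) auto
  moreover have "\<bar>cos \<theta> - cos \<phi>\<bar> = 2 * (\<bar>sin a\<bar> * \<bar>sin ((\<phi> - \<theta>) / 2)\<bar>)"
    by (simp add: cos_diff_cos a_def abs_mult)
  ultimately show ?thesis by (simp add: b_def)
qed

section \<open>Localized interpolation\<close>

text \<open>\<open>M\<close> joins two regimes: the trivial bound 1 near 0, and the decay like 1 /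
  |u| that the bounded sine in the numerator gives farther out.\<close>

lemma sine_quotient_kernel_decay:
  fixes u :: real
  assumes "\<bar>u\<bar> \<le> 2" and M: "M = max 1 ((2 * real v + 1) * \<bar>u\<bar> / 2)"
  shows "\<bar>poly (sine_quotient v) (u / 2) / (2 * real v + 1)\<bar> * M \<le> 1"
proof (cases "M = 1")
  case True
  then show ?thesis using sine_quotient_bounds(1)[of "u / 2" v] assms by (simp add: abs_divide)
next
  case False
  define N where "N = 2 * real v + 1"
  have N: "N > 0" by (simp add: N_def)
  have M': "M = N * \<bar>u\<bar> / 2" using M False by (auto simp: max_def N_def split: if_splits)
  have "\<bar>poly (sine_quotient v) (u / 2) / N\<bar> * M = \<bar>u / 2 * poly (sine_quotient v) (u / 2)\<bar>"
    using N unfolding M' by (simp add: abs_divide abs_mult)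
  also have "\<dots> \<le> 1" using assms(1) by (intro sine_quotient_bounds) simp
  finally show ?thesis by (simp add: N_def)
qed

text \<open>The last clause bounds a weighted Lebesgue function. Its weight absorbs errors that grow
  like the k-th power of the distance measured in units of 1 / n. Nodes may fill twice the interval
  of evaluation, so that x stays away from the ends, where Chebyshev nodes cluster.\<close>

definition localized_interpolant ::
    "nat \<Rightarrow> nat \<Rightarrow> real \<Rightarrow> real \<Rightarrow> nat \<Rightarrow> (nat \<Rightarrow> real) \<Rightarrow> (nat \<Rightarrow> real poly) \<Rightarrow> bool" where
  "localized_interpolant k n R C m y l \<longleftrightarrow>
      (\<forall>j<m. degree (l j) \<le> n \<and> \<bar>y j\<bar> \<le> 2 * R) \<and>
      (\<forall>q x. degree q \<le> k \<longrightarrow> (\<Sum>j<m. poly (l j) x * poly q (y j)) = poly q x) \<and>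
      (\<forall>x. \<bar>x\<bar> \<le> R \<longrightarrow> (\<Sum>j<m. \<bar>poly (l j) x\<bar> * (1 + real n * \<bar>x - y j\<bar>) ^ k) \<le> C)"

text \<open>Lagrange interpolation at the Chebyshev nodes, multiplied by a kernel that equals 1 on the
  diagonal and decays rapidly at the scale \<open>1 / n\<close>: the interpolation reproduces the product of
  the kernel with a polynomial of low degree, hence the polynomial itself.\<close>
lemma localized_interpolation_unit:
  fixes k :: nat
  obtains C :: real where "C > 0"
    "\<And>n. n \<ge> k \<Longrightarrow> \<exists>m y l. localized_interpolant k n (1/2) C m y l"
proof
  \<comment> \<open>The power 2 r of the kernel must pay for the weight of order k and leave
    exponent 2 for the summation over the nodes.\<close>
  define r where "r = k + 1"
  define c where "c = real (8 * r + k)"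
  have c: "c \<ge> 1" by (simp add: c_def r_def)
  define C where "C = 10 * (1 + 2 * c) ^ k * (2 * c)\<^sup>2 * (2 * pi)"
  show "C > 0" using c by (simp add: C_def)
  fix n assume n: "n \<ge> k"
  \<comment> \<open>The kernel has degree at most 4 r v and the Lagrange polynomials at most m - 1 =
    4 r v + k; together they must not exceed n. The rounding is harmless: n and m are both at most c
    N, so 1 / N can serve as the scale.\<close>
  define v where "v = (n - k) div (8 * r)"
  define N where "N = 2 * real v + 1"
  have N: "N \<ge> 1" by (simp add: N_def)
  define m where "m = 4 * r * v + k + 1"
  have v1: "8 * r * v \<le> n - k" by (simp add: v_def)
  have v2: "n - k < 8 * r * (v + 1)" unfolding v_def
    using dividend_less_div_times[of "8 * r" "n - k"] by (simp add: r_def algebra_simps)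
  have nc: "real n \<le> c * N"
  proof -
    have "n \<le> k + 8 * r * (v + 1)" using v2 by linarith
    also have "\<dots> \<le> (8 * r + k) * (2 * v + 1)" by (simp add: algebra_simps)
    finally have "real n \<le> real ((8 * r + k) * (2 * v + 1))" by (simp only: of_nat_le_iff)
    then show ?thesis unfolding c_def N_def by (simp add: algebra_simps)
  qed
  have mc: "real m \<le> c * N"
  proof -
    have "m \<le> (8 * r + k) * (2 * v + 1)" unfolding m_def r_def by (simp add: algebra_simps)
    then have "real m \<le> real ((8 * r + k) * (2 * v + 1))" by (simp only: of_nat_le_iff)
    then show ?thesis unfolding c_def N_def by (simp add: algebra_simps)
  qed
  have m0: "m > 0" by (simp add: m_def)
  \<comment> \<open>The argument is halved because differences x - y j lie in [-2, 2], while the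
    sine quotient is controlled on [-1, 1].\<close>
  define J where "J = (smult (1 / N) (sine_quotient v \<circ>\<^sub>p [:0, 1/2:])) ^ (2 * r)"
  have J: "poly J u = (poly (sine_quotient v) (u / 2) / N) ^ (2 * r)" for u
    by (simp add: J_def poly_pcompose)
  have J0: "poly J 0 = 1" using N unfolding J by (simp add: poly_sine_quotient_0 N_def)
  have degJ: "degree J \<le> 4 * r * v"
  proof -
    have "degree (smult (1 / N) (sine_quotient v \<circ>\<^sub>p [:0, 1/2:])) \<le> 2 * v"
      using degree_sine_quotient[of v] by (intro order_trans[OF degree_smult_le]) (simp add: degree_pcompose)
    then have "degree (smult (1 / N) (sine_quotient v \<circ>\<^sub>p [:0, 1/2:])) * (2 * r) \<le> 2 * v * (2 * r)"
      by (rule mult_right_mono) simp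
    moreover have "degree J \<le> degree (smult (1 / N) (sine_quotient v \<circ>\<^sub>p [:0, 1/2:])) * (2 * r)"
      unfolding J_def by (rule degree_power_le)
    ultimately have "degree J \<le> 2 * v * (2 * r)" by linarith
    then show ?thesis by (simp add: mult_ac)
  qed
  define y where "y = (\<lambda>j. cos (cheb_angle m j))"
  define l where "l = (\<lambda>j. cheb_lagrange m j * (J \<circ>\<^sub>p [:- y j, 1:]))"
  have l: "poly (l j) x = poly (cheb_lagrange m j) x * poly J (x - y j)" for j x
    by (simp add: l_def poly_pcompose)
  show "\<exists>m y l. localized_interpolant k n (1/2) C m y l"
    unfolding localized_interpolant_def
  proof (intro exI[of _ m] exI[of _ y] exI[of _ l] conjI allI impI)
    fix j
    have "degree (l j) \<le> (m - 1) + 4 * r * v" unfolding l_def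
      using degJ degree_cheb_lagrange[of m j]
      by (intro order_trans[OF degree_mult_le] add_mono) (simp_all add: degree_pcompose)
    then show "degree (l j) \<le> n" using v1 n by (simp add: m_def)
    show "\<bar>y j\<bar> \<le> 2 * (1/2)" by (simp add: y_def)
  next
    fix q :: "real poly" and x :: real
    assume q: "degree q \<le> k"
    define G where "G = (J \<circ>\<^sub>p [:x, -1:]) * q"
    have G: "poly G t = poly J (x - t) * poly q t" for t by (simp add: G_def poly_pcompose)
    have "degree G \<le> 4 * r * v + k" unfolding G_def
      using degJ q by (intro order_trans[OF degree_mult_le] add_mono) (simp_all add: degree_pcompose)
    then have "(\<Sum>j<m. poly (cheb_lagrange m j) x * poly G (cos (cheb_angle m j))) = poly G x"
      by (intro cheb_lagrange_interpolation) (simp add: m_def)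
    then show "(\<Sum>j<m. poly (l j) x * poly q (y j)) = poly q x"
      by (simp add: G l J0 y_def mult.assoc)
  next
    fix x :: real assume x: "\<bar>x\<bar> \<le> 1/2"
    define \<theta> where "\<theta> = arccos x"
    have \<theta>: "cos \<theta> = x" "0 \<le> \<theta>" "\<theta> \<le> pi" using x by (auto simp: \<theta>_def arccos_lbound arccos_ubound)
    \<comment> \<open>The fractional index at which the node angle would equal \<theta>.\<close>
    define \<tau> where "\<tau> = real m * \<theta> / pi - 1/2"
    have summand: "\<bar>poly (l j) x\<bar> * (1 + real n * \<bar>x - y j\<bar>) ^ k \<le>
        10 * (1 + 2 * c) ^ k * (2 * c)\<^sup>2 * (1 / (1 + (real j - \<tau>)\<^sup>2))" if j: "j < m" for j
    proof -
      define a where "a = \<bar>x - y j\<bar>"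
      have "\<bar>y j\<bar> \<le> 1" by (simp add: y_def)
      then have a: "0 \<le> a" "a \<le> 2" unfolding a_def using x by linarith+
      define b where "b = N * a"
      define M where "M = max 1 (b / 2)"
      have b: "b \<ge> 0" using N a by (simp add: b_def)
      have M: "M \<ge> 1" "b \<le> 2 * M" by (auto simp: M_def)
      have K: "\<bar>poly J (x - y j)\<bar> * M ^ (2 * r) \<le> 1"
      proof -
        have "\<bar>poly (sine_quotient v) ((x - y j) / 2) / N\<bar> * M \<le> 1" unfolding N_def
          by (rule sine_quotient_kernel_decay) (use a in \<open>auto simp: a_def M_def b_def N_def\<close>)
        then have "(\<bar>poly (sine_quotient v) ((x - y j) / 2) / N\<bar> * M) ^ (2 * r) \<le> 1"
          using M by (intro power_le_one) auto
        then show ?thesis unfolding J by (simp only: power_mult_distrib power_abs)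
      qed
      have "real n * a \<le> c * b" using mult_right_mono[OF nc a(1)] by (simp add: b_def mult.assoc)
      also have "\<dots> \<le> c * (2 * M)" using M c by (intro mult_left_mono) auto
      finally have "1 + real n * a \<le> (1 + 2 * c) * M" using M by (simp add: algebra_simps)
      then have na: "(1 + real n * a) ^ k \<le> ((1 + 2 * c) * M) ^ k" using a by (intro power_mono) auto
      have bM: "1 + b\<^sup>2 \<le> 5 * M\<^sup>2"
        using power_mono[OF M(2) b, of 2] power_mono[OF M(1), of 2] by (simp add: power_mult_distrib)
      have tb: "1 + (real j - \<tau>)\<^sup>2 \<le> (2 * c)\<^sup>2 * (1 + b\<^sup>2)"
      proof -
        have "cheb_angle m j \<ge> 0" by (simp add: cheb_angle_def)
        moreover have "(2 * real j + 1) * pi \<le> (2 * real m) * pi" using j by (intro mult_right_mono) auto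
        then have "cheb_angle m j \<le> pi" using m0 by (simp add: cheb_angle_def field_simps)
        ultimately have "\<bar>\<theta> - cheb_angle m j\<bar> \<le> 4 * a"
          using cos_separation[of \<theta> "cheb_angle m j"] \<theta> x by (simp add: a_def y_def)
        moreover have "real j - \<tau> = (real m / pi) * (cheb_angle m j - \<theta>)"
          using m0 by (simp add: \<tau>_def cheb_angle_def field_simps)
        then have "\<bar>real j - \<tau>\<bar> = (real m / pi) * \<bar>\<theta> - cheb_angle m j\<bar>"
          by (simp only: abs_mult abs_minus_commute[of \<theta>]) simp
        ultimately have "\<bar>real j - \<tau>\<bar> \<le> (real m / pi) * (4 * a)"
          by (simp only:) (intro mult_left_mono, auto)
        also have "\<dots> \<le> (c * N / pi) * (4 * a)" using mc a by (intro mult_right_mono divide_right_mono) auto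
        also have "\<dots> = (4 / pi) * (c * b)" by (simp add: b_def)
        also have "\<dots> \<le> 2 * (c * b)" using pi_ge_two b c by (intro mult_right_mono) (auto simp: field_simps)
        finally have "\<bar>real j - \<tau>\<bar>\<^sup>2 \<le> (2 * (c * b))\<^sup>2" by (intro power_mono) auto
        moreover have "1 \<le> (2 * c)\<^sup>2" using c by (intro one_le_power) auto
        ultimately show ?thesis by (simp add: power_mult_distrib distrib_left)
      qed
      have "\<bar>poly (l j) x\<bar> * (1 + real n * a) ^ k \<le> (2 * \<bar>poly J (x - y j)\<bar>) * ((1 + 2 * c) * M) ^ k"
        unfolding l abs_mult using abs_cheb_lagrange[of x m j] x m0 na a by (intro mult_mono) auto
      also have "\<dots> = 2 * (1 + 2 * c) ^ k * (\<bar>poly J (x - y j)\<bar> * M ^ k)" by (simp add: power_mult_distrib)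
      also have "\<dots> \<le> 2 * (1 + 2 * c) ^ k * (1 / M\<^sup>2)"
      proof (intro mult_left_mono)
        have "\<bar>poly J (x - y j)\<bar> * M ^ (k + 2) \<le> \<bar>poly J (x - y j)\<bar> * M ^ (2 * r)"
          using M by (intro mult_left_mono power_increasing) (auto simp: r_def)
        then have "\<bar>poly J (x - y j)\<bar> * M ^ k * M\<^sup>2 \<le> 1" using K unfolding power_add mult.assoc by linarith
        then show "\<bar>poly J (x - y j)\<bar> * M ^ k \<le> 1 / M\<^sup>2" using M by (simp add: pos_le_divide_eq)
      qed (use c in auto)
      also have "\<dots> \<le> 2 * (1 + 2 * c) ^ k * (5 * (2 * c)\<^sup>2 * (1 / (1 + (real j - \<tau>)\<^sup>2)))"
      proof (intro mult_left_mono)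
        have "1 + (real j - \<tau>)\<^sup>2 \<le> (2 * c)\<^sup>2 * (5 * M\<^sup>2)"
          using tb bM by (meson mult_left_mono order_trans zero_le_power2)
        moreover have "1 + (real j - \<tau>)\<^sup>2 > 0" by (simp add: add_pos_nonneg)
        ultimately show "1 / M\<^sup>2 \<le> 5 * (2 * c)\<^sup>2 * (1 / (1 + (real j - \<tau>)\<^sup>2))"
          using M by (simp add: field_simps)
      qed (use c in auto)
      finally show ?thesis by (simp add: a_def mult_ac)
    qed
    have "(\<Sum>j<m. \<bar>poly (l j) x\<bar> * (1 + real n * \<bar>x - y j\<bar>) ^ k) \<le>
        (\<Sum>j<m. 10 * (1 + 2 * c) ^ k * (2 * c)\<^sup>2 * (1 / (1 + (real j - \<tau>)\<^sup>2)))"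
      by (intro sum_mono summand) auto
    also have "\<dots> = 10 * (1 + 2 * c) ^ k * (2 * c)\<^sup>2 * (\<Sum>j<m. 1 / (1 + (real j - \<tau>)\<^sup>2))"
      by (simp add: sum_distrib_left)
    also have "\<dots> \<le> C" unfolding C_def
      using sum_inverse_shifted_squares[of \<tau> m] c by (intro mult_left_mono) auto
    finally show "(\<Sum>j<m. \<bar>poly (l j) x\<bar> * (1 + real n * \<bar>x - y j\<bar>) ^ k) \<le> C" .
  qed
qed

lemma localized_interpolation:
  fixes k :: nat and R :: real
  assumes R: "R > 0"
  obtains C :: real where "C > 0"
    "\<And>n. n \<ge> k \<Longrightarrow> \<exists>m y l. localized_interpolant k n R C m y l"
proof -
  obtain C where C: "C > 0" and main:
    "\<And>n. n \<ge> k \<Longrightarrow> \<exists>m y l. localized_interpolant k n (1/2) C m y l"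
    using localized_interpolation_unit[of k] by blast
  define s where "s = 2 * R"
  have s: "s > 0" using R by (simp add: s_def)
  show ?thesis
  proof
    \<comment> \<open>Stretching by s multiplies distances by s, and 1 + s a \<le> (1 + a) (1 + s)
      for a \<ge> 0; this is the source of the new factor.\<close>
    show "C * (1 + s) ^ k > 0" using C s by simp
    fix n assume "n \<ge> k"
    from main[OF this] obtain m y l where "localized_interpolant k n (1/2) C m y l" by blast
    then have deg: "\<And>j. j < m \<Longrightarrow> degree (l j) \<le> n" "\<And>j. j < m \<Longrightarrow> \<bar>y j\<bar> \<le> 1" and
      rep: "\<And>q x. degree q \<le> k \<Longrightarrow> (\<Sum>j<m. poly (l j) x * poly q (y j)) = poly q x" and
      sum: "\<And>x. \<bar>x\<bar> \<le> 1/2 \<Longrightarrow> (\<Sum>j<m. \<bar>poly (l j) x\<bar> * (1 + real n * \<bar>x - y j\<bar>) ^ k) \<le> C"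
      by (simp_all add: localized_interpolant_def)
    define l' where "l' = (\<lambda>j. l j \<circ>\<^sub>p [:0, 1 / s:])"
    have l': "poly (l' j) x = poly (l j) (x / s)" for j x by (simp add: l'_def poly_pcompose)
    show "\<exists>m y l. localized_interpolant k n R (C * (1 + s) ^ k) m y l"
      unfolding localized_interpolant_def
  proof (intro exI[of _ m] exI[of _ "\<lambda>j. s * y j"] exI[of _ l'] conjI allI impI)
      fix j assume j: "j < m"
      show "degree (l' j) \<le> n" using deg(1)[OF j] s by (simp add: l'_def degree_pcompose)
      show "\<bar>s * y j\<bar> \<le> 2 * R" using deg(2)[OF j] R by (simp add: s_def abs_mult)
    next
      fix q :: "real poly" and x :: real assume "degree q \<le> k"
      then have "degree (q \<circ>\<^sub>p [:0, s:]) \<le> k" by (simp add: degree_pcompose)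
      from rep[OF this, of "x / s"] show "(\<Sum>j<m. poly (l' j) x * poly q (s * y j)) = poly q x"
        using s by (simp add: l' poly_pcompose mult.commute)
    next
      fix x :: real assume x: "\<bar>x\<bar> \<le> R"
      have "(\<Sum>j<m. \<bar>poly (l' j) x\<bar> * (1 + real n * \<bar>x - s * y j\<bar>) ^ k) \<le>
        (\<Sum>j<m. (\<bar>poly (l j) (x / s)\<bar> * (1 + real n * \<bar>x / s - y j\<bar>) ^ k) * (1 + s) ^ k)"
      proof (rule sum_mono)
        fix j
        define t where "t = real n * \<bar>x / s - y j\<bar>"
        have t: "t \<ge> 0" by (simp add: t_def)
        have "x - s * y j = s * (x / s - y j)" using s by (simp add: field_simps)
        then have "real n * \<bar>x - s * y j\<bar> = s * t" using s by (simp add: abs_mult t_def)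
        then have "1 + real n * \<bar>x - s * y j\<bar> \<le> (1 + t) * (1 + s)" using t s by (simp add: algebra_simps)
        then have "(1 + real n * \<bar>x - s * y j\<bar>) ^ k \<le> ((1 + t) * (1 + s)) ^ k" by (intro power_mono) auto
        then have "\<bar>poly (l j) (x / s)\<bar> * (1 + real n * \<bar>x - s * y j\<bar>) ^ k \<le>
            \<bar>poly (l j) (x / s)\<bar> * ((1 + t) * (1 + s)) ^ k" by (rule mult_left_mono) simp
        then show "\<bar>poly (l' j) x\<bar> * (1 + real n * \<bar>x - s * y j\<bar>) ^ k \<le>
           (\<bar>poly (l j) (x / s)\<bar> * (1 + real n * \<bar>x / s - y j\<bar>) ^ k) * (1 + s) ^ k"
          by (simp add: l' t_def power_mult_distrib mult.assoc)
      qed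
      also have "\<dots> = (\<Sum>j<m. \<bar>poly (l j) (x / s)\<bar> * (1 + real n * \<bar>x / s - y j\<bar>) ^ k) * (1 + s) ^ k"
        by (simp add: sum_distrib_right)
      also have "\<dots> \<le> C * (1 + s) ^ k"
        using sum[of "x / s"] x s by (intro mult_right_mono) (auto simp: s_def abs_divide field_simps)
      finally show "(\<Sum>j<m. \<bar>poly (l' j) x\<bar> * (1 + real n * \<bar>x - s * y j\<bar>) ^ k) \<le> C * (1 + s) ^ k" .
    qed
  qed
qed

section \<open>Polynomials of bounded total degree\<close>

lemma finite_multiindices: "finite {\<alpha> :: 'd::finite \<Rightarrow> nat. sum \<alpha> UNIV \<le> n}"
proof (rule finite_subset)
  show "{\<alpha> :: 'd \<Rightarrow> nat. sum \<alpha> UNIV \<le> n} \<subseteq> UNIV \<rightarrow>\<^sub>E {..n}"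
  proof
    fix \<alpha> :: "'d \<Rightarrow> nat" assume "\<alpha> \<in> {\<alpha>. sum \<alpha> UNIV \<le> n}"
    then have "\<alpha> i \<le> n" for i using member_le_sum[of i UNIV \<alpha>] by simp
    then show "\<alpha> \<in> UNIV \<rightarrow>\<^sub>E {..n}" by auto
  qed
qed (simp add: finite_PiE)

lemma zero_total_degree: "(\<lambda>x. 0) \<in> total_degree_polys n"
  unfolding total_degree_polys_def by (auto intro!: exI[of _ "\<lambda>_. 0"])

lemma add_total_degree:
  assumes "p \<in> total_degree_polys n" "q \<in> total_degree_polys n"
  shows "(\<lambda>x. p x + q x) \<in> total_degree_polys n"
proof -
  obtain c c' where "p = (\<lambda>x. \<Sum>\<alpha> | sum \<alpha> UNIV \<le> n. c \<alpha> * (\<Prod>r\<in>UNIV. (x $ r) ^ \<alpha> r))"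
    "q = (\<lambda>x. \<Sum>\<alpha> | sum \<alpha> UNIV \<le> n. c' \<alpha> * (\<Prod>r\<in>UNIV. (x $ r) ^ \<alpha> r))"
    using assms unfolding total_degree_polys_def by blast
  then show ?thesis unfolding total_degree_polys_def
    by (auto intro!: exI[of _ "\<lambda>\<alpha>. c \<alpha> + c' \<alpha>"] simp: sum.distrib distrib_right)
qed

lemma scale_total_degree:
  assumes "p \<in> total_degree_polys n"
  shows "(\<lambda>x. a * p x) \<in> total_degree_polys n"
proof -
  obtain c where "p = (\<lambda>x. \<Sum>\<alpha> | sum \<alpha> UNIV \<le> n. c \<alpha> * (\<Prod>r\<in>UNIV. (x $ r) ^ \<alpha> r))"
    using assms unfolding total_degree_polys_def by blast
  then show ?thesis unfolding total_degree_polys_def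
    by (auto intro!: exI[of _ "\<lambda>\<alpha>. a * c \<alpha>"] simp: sum_distrib_left mult.assoc)
qed

lemma diff_total_degree:
  assumes "p \<in> total_degree_polys n" "q \<in> total_degree_polys n"
  shows "(\<lambda>x. p x - q x) \<in> total_degree_polys n"
  using add_total_degree[OF assms(1) scale_total_degree[OF assms(2), of "-1"]] by simp

lemma sum_total_degree:
  assumes "\<And>a. a \<in> A \<Longrightarrow> p a \<in> total_degree_polys n"
  shows "(\<lambda>x. \<Sum>a\<in>A. p a x) \<in> total_degree_polys n"
  using assms by (induction A rule: infinite_finite_induct)
    (auto intro: zero_total_degree add_total_degree)

lemma monomial_total_degree:
  assumes "sum \<alpha> UNIV \<le> n"
  shows "(\<lambda>x :: real ^ 'd::finite. \<Prod>r\<in>UNIV. (x $ r) ^ \<alpha> r) \<in> total_degree_polys n"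
proof -
  have "(\<Sum>\<beta> | sum \<beta> UNIV \<le> n. (if \<beta> = \<alpha> then 1 else 0) * (\<Prod>r\<in>UNIV. (x $ r) ^ \<beta> r)) =
      (\<Prod>r\<in>UNIV. (x $ r) ^ \<alpha> r)" for x :: "real ^ 'd"
    using assms by (simp add: if_distrib[of "\<lambda>t. t * _"] finite_multiindices cong: if_cong)
  then show ?thesis unfolding total_degree_polys_def
    by (auto intro!: exI[of _ "\<lambda>\<beta>. if \<beta> = \<alpha> then 1 else 0"])
qed

lemma prod_total_degree:
  fixes P :: "'d::finite \<Rightarrow> real poly"
  assumes "(\<Sum>i\<in>UNIV. degree (P i)) \<le> n"
  shows "(\<lambda>x :: real ^ 'd. \<Prod>i\<in>UNIV. poly (P i) (x $ i)) \<in> total_degree_polys n"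
proof -
  have "(\<lambda>x :: real ^ 'd. \<Prod>i\<in>UNIV. poly (P i) (x $ i)) =
    (\<lambda>x. \<Sum>\<alpha>\<in>(\<Pi>\<^sub>E i\<in>UNIV. {..degree (P i)}). (\<Prod>i\<in>UNIV. coeff (P i) (\<alpha> i)) * (\<Prod>i\<in>UNIV. (x $ i) ^ \<alpha> i))"
    unfolding poly_altdef by (subst prod_sum_PiE) (auto simp: prod.distrib)
  moreover have "sum \<alpha> UNIV \<le> n" if "\<alpha> \<in> (\<Pi>\<^sub>E i\<in>UNIV. {..degree (P i)})" for \<alpha>
  proof -
    have "sum \<alpha> UNIV \<le> (\<Sum>i\<in>UNIV. degree (P i))" using that by (intro sum_mono) (auto simp: PiE_iff)
    then show ?thesis using assms by linarith
  qed
  ultimately show ?thesis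
    by (auto intro!: sum_total_degree scale_total_degree monomial_total_degree)
qed

text \<open>The passage from one variable to several: growth and Bernstein estimates are always
  applied along a line, without loss in the degree.\<close>

lemma total_degree_on_line:
  fixes x v :: "real ^ 'd::finite"
  assumes "q \<in> total_degree_polys n"
  obtains r where "degree r \<le> n" "\<And>t. poly r t = q (x + t *\<^sub>R v)"
proof -
  obtain c where q: "q = (\<lambda>x. \<Sum>\<alpha> | sum \<alpha> UNIV \<le> n. c \<alpha> * (\<Prod>r\<in>UNIV. (x $ r) ^ \<alpha> r))"
    using assms unfolding total_degree_polys_def by blast
  define r where "r = (\<Sum>\<alpha> | sum \<alpha> UNIV \<le> n. smult (c \<alpha>) (\<Prod>i\<in>UNIV. [:x $ i, v $ i:] ^ \<alpha> i))"
  show ?thesis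
  proof
    have "degree (smult (c \<alpha>) (\<Prod>i\<in>UNIV. [:x $ i, v $ i:] ^ \<alpha> i)) \<le> n" if "sum \<alpha> UNIV \<le> n" for \<alpha>
    proof -
      have "degree (\<Prod>i\<in>UNIV. [:x $ i, v $ i:] ^ \<alpha> i) \<le> (\<Sum>i\<in>UNIV. degree ([:x $ i, v $ i:] ^ \<alpha> i))"
        using degree_prod_sum_le[of "UNIV :: 'd set" "\<lambda>i. [:x $ i, v $ i:] ^ \<alpha> i"] by (simp add: o_def)
      also have "\<dots> \<le> sum \<alpha> UNIV"
      proof (rule sum_mono)
        fix i
        have "degree ([:x $ i, v $ i:] ^ \<alpha> i) \<le> degree [:x $ i, v $ i:] * \<alpha> i"
          by (rule degree_power_le)
        also have "\<dots> \<le> 1 * \<alpha> i" by (intro mult_right_mono) auto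
        finally show "degree ([:x $ i, v $ i:] ^ \<alpha> i) \<le> \<alpha> i" by simp
      qed
      finally show ?thesis using that degree_smult_le[of "c \<alpha>"] order_trans by meson
    qed
    then show "degree r \<le> n" unfolding r_def by (intro degree_sum_le finite_multiindices) auto
    show "poly r t = q (x + t *\<^sub>R v)" for t
      by (simp add: r_def q poly_sum poly_prod)
  qed
qed

lemma continuous_on_total_degree:
  assumes "q \<in> total_degree_polys n"
  shows "continuous_on A q"
  using assms unfolding total_degree_polys_def by (auto intro!: continuous_intros)

section \<open>Norming meshes on convex bodies\<close>

lemma convex_contraction:
  fixes B :: "'a::real_vector set"
  assumes "convex B" "b \<in> B" "x \<in> B" "0 \<le> t" "t \<le> 1"
  shows "b + t *\<^sub>R (x - b) \<in> B"
  using convexD_alt[OF assms(1-3), of t] assms(4,5) by (simp add: algebra_simps)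

text \<open>Seen from b, a point of the body scaled by \<alpha> may move towards q all the way, and
  away from q by the fraction \<delta> / 2, without leaving the body scaled by \<alpha> + \<delta>.
  Comparing coefficients exhibits x' as a convex combination of x and b + \<mu> (q - b) with \<mu>
  in [-1, 2]; the two assumptions on q put the ends of this range into B.\<close>

lemma shrunken_body_segment:
  fixes B :: "'a::real_vector set"
  assumes B: "convex B" "x \<in> B" and q: "b - (q - b) \<in> B" "b + 2 *\<^sub>R (q - b) \<in> B"
    and \<alpha>: "1/2 \<le> \<alpha>" "\<alpha> \<le> 1" and \<delta>: "\<delta> > 0" and \<tau>: "- \<delta> / 2 \<le> \<tau>" "\<tau> \<le> 1"
  obtains x' where "x' \<in> B"
    "b + \<alpha> *\<^sub>R (x - b) + \<tau> *\<^sub>R (q - (b + \<alpha> *\<^sub>R (x - b))) = b + (\<alpha> + \<delta>) *\<^sub>R (x' - b)"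
proof -
  \<comment> \<open>What remains of \<alpha> + \<delta> after x has received its share (1 - \<tau>)
    \<alpha>.\<close>
  define u where "u = \<delta> + \<tau> * \<alpha>"
  have u: "u > 0" "u \<ge> - \<tau>" "u \<ge> \<tau> / 2"
  proof -
    have "u \<ge> \<delta> / 2" if "\<tau> < 0"
    proof -
      have "\<tau> * 1 \<le> \<tau> * \<alpha>" using that \<alpha> by (intro mult_left_mono_neg) auto
      then show ?thesis using \<tau> by (simp add: u_def)
    qed
    moreover have "u \<ge> \<delta> + \<tau> / 2" if "\<tau> \<ge> 0"
      using mult_left_mono[of "1/2" \<alpha> \<tau>] that \<alpha> by (simp add: u_def)
    ultimately show "u > 0" "u \<ge> - \<tau>" "u \<ge> \<tau> / 2"
      using \<tau> \<delta> by (cases "\<tau> < 0"; simp)+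
  qed
  define \<mu> where "\<mu> = \<tau> / u"
  have \<mu>: "-1 \<le> \<mu>" "\<mu> \<le> 2" "\<mu> * u = \<tau>" using u by (auto simp: \<mu>_def field_simps)
  define b' where "b' = (b - (q - b)) + ((\<mu> + 1) / 3) *\<^sub>R ((b + 2 *\<^sub>R (q - b)) - (b - (q - b)))"
  have b'B: "b' \<in> B" unfolding b'_def by (rule convex_contraction) (use B q \<mu> in auto)
  have "(b + 2 *\<^sub>R (q - b)) - (b - (q - b)) = (2 + 1) *\<^sub>R (q - b)"
    unfolding scaleR_left_distrib by simp
  then have "b' = b - (q - b) + (\<mu> + 1) *\<^sub>R (q - b)" by (simp add: b'_def)
  then have b': "b' - b = \<mu> *\<^sub>R (q - b)" unfolding scaleR_left_distrib by simp
  define w where "w = u / (\<alpha> + \<delta>)"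
  have ad: "\<alpha> + \<delta> > 0" using \<alpha> \<delta> by simp
  have wu: "(\<alpha> + \<delta>) * w = u" using ad by (simp add: w_def)
  have "u \<le> \<alpha> + \<delta>" unfolding u_def using \<tau> \<alpha> mult_right_mono[of \<tau> 1 \<alpha>] by auto
  then have w: "0 \<le> w" "w \<le> 1" using u ad by (auto simp: w_def)
  define x' where "x' = x + w *\<^sub>R (b' - x)"
  have "x' \<in> B" unfolding x'_def by (rule convex_contraction) (use B b'B w in auto)
  moreover have "(\<alpha> + \<delta>) *\<^sub>R (x' - b) = (\<alpha> + \<delta> - (\<alpha> + \<delta>) * w) *\<^sub>R (x - b) + ((\<alpha> + \<delta>) * w) *\<^sub>R (b' - b)"
    by (simp add: x'_def algebra_simps)
  then have "(\<alpha> + \<delta>) *\<^sub>R (x' - b) = (\<alpha> - \<tau> * \<alpha>) *\<^sub>R (x - b) + \<tau> *\<^sub>R (q - b)"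
    unfolding wu b' using \<mu>(3) by (simp add: mult.commute[of u]) (simp add: u_def)
  then have "b + \<alpha> *\<^sub>R (x - b) + \<tau> *\<^sub>R (q - (b + \<alpha> *\<^sub>R (x - b))) = b + (\<alpha> + \<delta>) *\<^sub>R (x' - b)"
    by (simp add: algebra_simps)
  ultimately show ?thesis using that by blast
qed

lemma pigeonhole_ratio:
  fixes V :: "nat \<Rightarrow> real"
  assumes "N > 0" "R > 0" "V 0 \<le> R ^ N * V N"
  obtains i where "i < N" "V i \<le> R * V (Suc i)"
proof (rule ccontr)
  assume no: "\<not> thesis"
  note found = that
  have *: "V i > R * V (Suc i)" if "i < N" for i using found[OF that] no by force
  have "V 0 > R ^ Suc i * V (Suc i)" if "i < N" for i
    using that
  proof (induction i)
    case (Suc i)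
    have "R ^ Suc i * V (Suc i) > R ^ Suc i * (R * V (Suc (Suc i)))"
      using *[OF Suc.prems] assms by (intro mult_strict_left_mono) auto
    with Suc show ?case by (simp add: mult_ac)
  qed (use *[of 0] in auto)
  from this[of "N - 1"] assms show False by simp
qed

text \<open>\<open>Q\<close> is a core around b. Mesh points are sought on segments towards this
  core, because there \<open>shrunken_body_segment\<close> leaves a margin behind the starting
  point. The constant found is of size exp (3 A^2), but A depends on C alone.\<close>

theorem norming_mesh:
  fixes B Q :: "(real ^ 'd::finite) set"
  assumes B: "compact B" "convex B" "b \<in> B"
    and Q: "\<And>q. q \<in> Q \<Longrightarrow> b - (q - b) \<in> B \<and> b + 2 *\<^sub>R (q - b) \<in> B"
    and C: "C > 0"
  shows "\<exists>K n0. \<forall>n\<ge>n0. \<forall>X p \<epsilon>. p \<in> total_degree_polys n \<longrightarrow>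
    (\<forall>z\<in>B. \<exists>y\<in>X. \<exists>q\<in>Q. y = z + (C / (real n)\<^sup>2) *\<^sub>R (q - z)) \<longrightarrow>
    (\<forall>y\<in>X. \<bar>p y\<bar> \<le> \<epsilon>) \<longrightarrow> (\<forall>x\<in>B. \<bar>p x\<bar> \<le> K * \<epsilon>)"
proof -
  \<comment> \<open>1000 exceeds 12 * (3/2) * 54 = 972. With sqrt 2 \<le> 3/2 the Bernstein step
    then changes p by at most \<open>V i / 54\<close>, and e^3 \<le> 27 turns this into half of
    \<open>V (Suc i)\<close>.\<close>
  define A where "A = nat \<lceil>1000 * C\<rceil> + 1"
  have A: "real A \<ge> 1000 * C" "A > 0" unfolding A_def by linarith+
  define N where "N = A\<^sup>2"
  have N: "N > 0" using A by (simp add: N_def)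
  \<comment> \<open>The first summand makes the total shrinkage N \<delta> at most 1/4; the second
    makes the relative distance s to the mesh point at most 1/2.\<close>
  define n0 where "n0 = 2 * A\<^sup>2 + nat \<lceil>2 * C\<rceil> + 1"
  have "\<bar>p x\<bar> \<le> (2 * exp (3 * real N)) * \<epsilon>"
    if n: "n \<ge> n0" and p: "p \<in> total_degree_polys n"
      and mesh: "\<And>z. z \<in> B \<Longrightarrow> \<exists>y\<in>X. \<exists>q\<in>Q. y = z + (C / (real n)\<^sup>2) *\<^sub>R (q - z)"
      and X: "\<And>y. y \<in> X \<Longrightarrow> \<bar>p y\<bar> \<le> \<epsilon>" and x: "x \<in> B" for n X p \<epsilon> x
  proof -
    have n_pos: "n > 0" and nA: "real n \<ge> 2 * real A ^ 2" and nC: "real n \<ge> 2 * C"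
    proof -
      show "n > 0" using n by (simp add: n0_def)
      have "real n \<ge> real n0" using n by simp
      moreover have "real n0 \<ge> 2 * real A ^ 2" "real n0 \<ge> 2 * C" unfolding n0_def by (simp, linarith)
      ultimately show "real n \<ge> 2 * real A ^ 2" "real n \<ge> 2 * C" by linarith+
    qed
    define s where "s = C / (real n)\<^sup>2"
    define \<delta> where "\<delta> = (real A / real n)\<^sup>2"
    have \<delta>: "\<delta> > 0" using A n_pos by (simp add: \<delta>_def)
    have N\<delta>: "real N * \<delta> = (real A ^ 2 / real n)\<^sup>2" by (simp add: \<delta>_def N_def power_divide flip: power_add power_mult)
    have "real A ^ 2 / real n \<le> 1/2" using nA n_pos by (simp add: field_simps)
    then have "(real A ^ 2 / real n)\<^sup>2 \<le> (1/2)\<^sup>2" by (intro power_mono) auto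
    then have N\<delta>4: "real N * \<delta> \<le> 1/4" unfolding N\<delta> by (simp add: power2_eq_square)
    have i\<delta>: "real i * \<delta> \<le> 1/4" if "i \<le> N" for i
      using mult_right_mono[of "real i" "real N" \<delta>] that \<delta> N\<delta>4 by linarith
    define Bs where "Bs = (\<lambda>i. (\<lambda>x. b + (1 - real i * \<delta>) *\<^sub>R (x - b)) ` B)"
    have cpt: "compact ((\<lambda>x. \<bar>p x\<bar>) ` Bs i)" for i
      unfolding Bs_def using B
      by (intro compact_continuous_image continuous_intros continuous_on_total_degree[OF p]) auto
    define V where "V = (\<lambda>i. Sup ((\<lambda>x. \<bar>p x\<bar>) ` Bs i))"
    have V_ge: "\<bar>p y\<bar> \<le> V i" if "y \<in> Bs i" for y i
      unfolding V_def using that cpt[of i] by (intro cSup_upper) (auto simp: compact_imp_bounded bounded_imp_bdd_above)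
    have V_att: "\<exists>z\<in>Bs i. \<bar>p z\<bar> = V i" for i
    proof -
      have "(\<lambda>x. \<bar>p x\<bar>) ` Bs i \<noteq> {}" using B by (auto simp: Bs_def)
      then have "V i \<in> (\<lambda>x. \<bar>p x\<bar>) ` Bs i" unfolding V_def
        using cpt[of i] by (intro closed_contains_Sup) (auto simp: compact_imp_closed compact_imp_bounded bounded_imp_bdd_above)
      then show ?thesis by auto
    qed
    have V_nonneg: "V i \<ge> 0" for i using V_att[of i] by force
    have mono: "Bs j \<subseteq> Bs i" if "i \<le> j" "j \<le> N" for i j
    proof
      fix y assume "y \<in> Bs j"
      then obtain x where x: "x \<in> B" "y = b + (1 - real j * \<delta>) *\<^sub>R (x - b)" by (auto simp: Bs_def)
      have le: "real i * \<delta> \<le> real j * \<delta>" using that \<delta> by simp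
      have pos: "1 - real j * \<delta> > 0" "1 - real i * \<delta> > 0" using i\<delta>[of j] i\<delta>[of i] that by linarith+
      define t where "t = (1 - real j * \<delta>) / (1 - real i * \<delta>)"
      have t: "0 \<le> t" "t \<le> 1" "(1 - real i * \<delta>) * t = 1 - real j * \<delta>" using le pos by (auto simp: t_def)
      have "b + t *\<^sub>R (x - b) \<in> B" using convex_contraction B x t by blast
      moreover have "y = b + (1 - real i * \<delta>) *\<^sub>R ((b + t *\<^sub>R (x - b)) - b)" using x t by simp
      ultimately show "y \<in> Bs i" unfolding Bs_def by blast
    qed
    have growth: "\<bar>p x\<bar> \<le> exp 3 ^ N * V N" if x: "x \<in> B" for x
    proof -
      define v where "v = (1 - real N * \<delta>) *\<^sub>R (x - b)"
      obtain r where r: "degree r \<le> n" "\<And>t. poly r t = p ((b + v) + t *\<^sub>R (- v))"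
        using total_degree_on_line[OF p] by blast
      \<comment> \<open>On the line through b and x, the image of x in the smallest body has
        parameter 0, b has parameter 1, and x itself has parameter -t.\<close>
      define t where "t = real N * \<delta> / (1 - real N * \<delta>)"
      have t0: "t \<ge> 0" using \<delta> N\<delta>4 by (simp add: t_def)
      have "\<bar>poly r (- t)\<bar> \<le> V N * exp (2 * real n * sqrt t)"
      proof (rule poly_growth_outside[OF r(1) _ t0])
        fix \<tau> :: real assume \<tau>: "0 \<le> \<tau>" "\<tau> \<le> 1"
        have "b + (1 - \<tau>) *\<^sub>R (x - b) \<in> B" using \<tau> by (intro convex_contraction B x) auto
        moreover have "(b + v) + \<tau> *\<^sub>R (- v) = b + (1 - real N * \<delta>) *\<^sub>R ((b + (1 - \<tau>) *\<^sub>R (x - b)) - b)"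
          by (simp add: v_def algebra_simps)
        ultimately have "(b + v) + \<tau> *\<^sub>R (- v) \<in> Bs N" unfolding Bs_def by blast
        then show "\<bar>poly r \<tau>\<bar> \<le> V N" unfolding r by (rule V_ge)
      qed
      also have "poly r (- t) = p x"
      proof -
        have "(1 + t) * (1 - real N * \<delta>) = 1" using N\<delta>4 by (simp add: t_def field_simps)
        then have "(1 + t) *\<^sub>R v = x - b" by (simp add: v_def)
        then have "v + t *\<^sub>R v = x - b" by (simp add: algebra_simps)
        then show ?thesis unfolding r by (simp add: add.assoc)
      qed
      also have "2 * real n * sqrt t \<le> 3 * real N"
      proof -
        have "t \<le> real N * \<delta> / (3/4)" unfolding t_def using N\<delta>4 \<delta> by (intro divide_left_mono) auto
        also have "\<dots> \<le> 9/4 * (real N * \<delta>)" using \<delta> by simp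
        also have "\<dots> = (3/2 * (real A ^ 2 / real n))\<^sup>2" unfolding N\<delta> power_mult_distrib by (simp add: power2_eq_square)
        finally have "sqrt t \<le> 3/2 * (real A ^ 2 / real n)" by (intro real_le_lsqrt) auto
        then have "real n * sqrt t \<le> real n * (3/2 * (real A ^ 2 / real n))" by (intro mult_left_mono) auto
        then show ?thesis using n_pos by (simp add: N_def)
      qed
      then have "V N * exp (2 * real n * sqrt t) \<le> V N * exp (real N * 3)"
        using V_nonneg by (intro mult_left_mono) auto
      finally show ?thesis by (simp add: mult.commute exp_of_nat_mult)
    qed
    have "V 0 \<le> exp 3 ^ N * V N"
    proof -
      obtain z where "z \<in> Bs 0" "\<bar>p z\<bar> = V 0" using V_att by blast
      then show ?thesis using growth[of z] by (auto simp: Bs_def)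
    qed
    then obtain i where i: "i < N" "V i \<le> exp 3 * V (Suc i)"
      using pigeonhole_ratio[OF N, of "exp 3" V] by auto
    \<comment> \<open>A maximum point of |p| on the smaller body. By the choice of i, the bound on
      \<open>Bs i\<close> is at most e^3 times larger, so p changes by at most half of this maximum
      on the way to the mesh point, whose value is therefore comparable to it.\<close>
    obtain z where z: "z \<in> Bs (Suc i)" "\<bar>p z\<bar> = V (Suc i)" using V_att by blast
    then obtain \<xi> where \<xi>: "\<xi> \<in> B" "z = b + (1 - real (Suc i) * \<delta>) *\<^sub>R (\<xi> - b)" by (auto simp: Bs_def)
    have "z \<in> B" using mono[of 0 "Suc i"] i z by (auto simp: Bs_def)
    then obtain y q where yq: "y \<in> X" "q \<in> Q" "y = z + s *\<^sub>R (q - z)" using mesh s_def by blast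
    obtain r where r: "degree r \<le> n" "\<And>t. poly r t = p (z + t *\<^sub>R (q - z))"
      using total_degree_on_line[OF p] by blast
    have "\<bar>poly r s - poly r 0\<bar> \<le> 12 * real n * V i * s / sqrt (\<delta> / 2)"
    proof (rule bernstein_endpoint[OF r(1) n_pos])
      fix \<tau> assume \<tau>: "- (\<delta> / 2) \<le> \<tau>" "\<tau> \<le> 1"
      have i': "real (Suc i) * \<delta> \<le> 1/4" "0 \<le> real (Suc i) * \<delta>" using i\<delta>[of "Suc i"] i \<delta> by auto
      obtain x' where "x' \<in> B" "z + \<tau> *\<^sub>R (q - z) = b + ((1 - real (Suc i) * \<delta>) + \<delta>) *\<^sub>R (x' - b)"
        unfolding \<xi>(2)
        by (rule shrunken_body_segment[OF \<open>convex B\<close> \<xi>(1), of b q "1 - real (Suc i) * \<delta>" \<delta> \<tau>])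
          (use Q yq \<delta> \<tau> i' in auto)
      moreover have "(1 - real (Suc i) * \<delta>) + \<delta> = 1 - real i * \<delta>" by (simp add: algebra_simps)
      ultimately have "z + \<tau> *\<^sub>R (q - z) = b + (1 - real i * \<delta>) *\<^sub>R (x' - b)" by metis
      then have "z + \<tau> *\<^sub>R (q - z) \<in> Bs i" unfolding Bs_def using \<open>x' \<in> B\<close> by blast
      then show "\<bar>poly r \<tau>\<bar> \<le> V i" unfolding r by (rule V_ge)
    next
      show "0 < \<delta> / 2" "0 \<le> s" using \<delta> C by (auto simp: s_def)
      show "\<delta> / 2 \<le> 1" using i\<delta>[of 1] N by simp
      have "real n * 1 \<le> real n * real n" using n_pos by (intro mult_left_mono) auto
      then have "2 * C \<le> (real n)\<^sup>2" using nC unfolding power2_eq_square by linarith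
      then show "s \<le> 1/2" unfolding s_def using n_pos by (simp add: field_simps)
    qed
    also have "sqrt (\<delta> / 2) = real A / real n / sqrt 2"
      by (simp add: \<delta>_def real_sqrt_divide)
    also have "12 * real n * V i * s / (real A / real n / sqrt 2) = (12 * sqrt 2 * C / real A) * V i"
      using n_pos A by (simp add: s_def field_simps power2_eq_square)
    also have "\<dots> \<le> (1 / 54) * V i"
    proof (rule mult_right_mono[OF _ V_nonneg])
      have "sqrt 2 \<le> 3/2" by (rule real_le_lsqrt) (auto simp: power2_eq_square)
      then have "12 * sqrt 2 * C * 54 \<le> 12 * (3/2) * C * 54" using C by simp
      also have "\<dots> \<le> real A" using A C by linarith
      finally show "12 * sqrt 2 * C / real A \<le> 1 / 54" using A by (simp add: field_simps)
    qed
    also have "\<dots> \<le> (1 / 54) * (27 * V (Suc i))"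
    proof -
      have "exp (3::real) = exp 1 ^ 3" using exp_of_nat_mult[of 3 "1::real"] by simp
      also have "\<dots> \<le> 3 ^ 3" using exp_le by (intro power_mono) auto
      finally have "exp 3 * V (Suc i) \<le> 27 * V (Suc i)" using V_nonneg by (intro mult_right_mono) auto
      then show ?thesis using i by simp
    qed
    finally have "\<bar>p y - p z\<bar> \<le> V (Suc i) / 2" by (simp add: r yq)
    then have "V (Suc i) \<le> 2 * \<epsilon>" using X[OF yq(1)] z by linarith
    \<comment> \<open>Controlling one intermediate body is enough: the innermost maximum is no
      larger, and \<open>growth\<close> recovers all of B from it.\<close>
    moreover have "V N \<le> V (Suc i)"
      using V_att[of N] mono[of "Suc i" N] i V_ge[of _ "Suc i"] by fastforce
    ultimately have "exp 3 ^ N * V N \<le> exp 3 ^ N * (2 * \<epsilon>)" by (intro mult_left_mono) auto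
    with growth[OF x] have "\<bar>p x\<bar> \<le> exp 3 ^ N * (2 * \<epsilon>)" by (rule order_trans)
    moreover have "exp (3 * real N) = exp 3 ^ N" by (metis exp_of_nat_mult mult.commute)
    ultimately show ?thesis by (simp add: mult_ac)
  qed
  then show ?thesis by (intro exI[of _ "2 * exp (3 * real N)"] exI[of _ n0]) blast
qed

section \<open>Approximation of smooth functions\<close>

text \<open>Encoded as a translation along an axis, to match the form of the partial derivatives in
  \<open>continuously_differentiable_to_order\<close>.\<close>

definition coord_upd :: "real ^ 'd::finite \<Rightarrow> 'd \<Rightarrow> real \<Rightarrow> real ^ 'd" where
  "coord_upd z a t = z + (t - z $ a) *\<^sub>R axis a 1"

lemma coord_upd_nth: "coord_upd z a t $ i = (if i = a then t else z $ i)"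
  by (simp add: coord_upd_def axis_def)

lemma coord_upd_self: "coord_upd z a (z $ a) = z"
  by (simp add: coord_upd_def)

lemma dist_coord_upd: "dist z (coord_upd z a t) = \<bar>t - z $ a\<bar>"
  by (simp add: coord_upd_def dist_norm norm_axis_1)

lemma coord_upd_add: "coord_upd z a t + h *\<^sub>R axis a 1 = coord_upd z a (t + h)"
  by (simp add: coord_upd_def algebra_simps)

lemma localized_interpolant_abs_sum:
  assumes "localized_interpolant k n R C m y l" "\<bar>x\<bar> \<le> R"
  shows "(\<Sum>j<m. \<bar>poly (l j) x\<bar>) \<le> C"
proof -
  have "(\<Sum>j<m. \<bar>poly (l j) x\<bar>) \<le> (\<Sum>j<m. \<bar>poly (l j) x\<bar> * (1 + real n * \<bar>x - y j\<bar>) ^ k)"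
  proof (rule sum_mono)
    fix j
    have "\<bar>poly (l j) x\<bar> * 1 \<le> \<bar>poly (l j) x\<bar> * (1 + real n * \<bar>x - y j\<bar>) ^ k"
      by (intro mult_left_mono one_le_power) auto
    then show "\<bar>poly (l j) x\<bar> \<le> \<bar>poly (l j) x\<bar> * (1 + real n * \<bar>x - y j\<bar>) ^ k" by simp
  qed
  then show ?thesis using assms unfolding localized_interpolant_def by force
qed

text \<open>As T is reproduced, only the remainder is interpolated. Writing its k-th power of the
  distance as n^(-k) times a power of n |t - t0| lets the weight absorb it.\<close>

lemma localized_interpolant_error:
  assumes L: "localized_interpolant k n R C m y l" "\<bar>t\<^sub>0\<bar> \<le> R" and n: "n > 0"
    and T: "degree T \<le> k" "poly T t\<^sub>0 = \<phi> t\<^sub>0"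
    and M: "\<And>t. \<bar>t\<bar> \<le> 2 * R \<Longrightarrow> \<bar>\<phi> t - poly T t\<bar> \<le> M * \<bar>t - t\<^sub>0\<bar> ^ k" "M \<ge> 0"
  shows "\<bar>\<phi> t\<^sub>0 - (\<Sum>j<m. poly (l j) t\<^sub>0 * \<phi> (y j))\<bar> \<le> M * C / real n ^ k"
proof -
  have "\<phi> t\<^sub>0 = (\<Sum>j<m. poly (l j) t\<^sub>0 * poly T (y j))"
    using L T unfolding localized_interpolant_def by simp
  then have "\<bar>\<phi> t\<^sub>0 - (\<Sum>j<m. poly (l j) t\<^sub>0 * \<phi> (y j))\<bar> = \<bar>\<Sum>j<m. poly (l j) t\<^sub>0 * (poly T (y j) - \<phi> (y j))\<bar>"
    by (simp add: right_diff_distrib sum_subtractf)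
  also have "\<dots> \<le> (\<Sum>j<m. \<bar>poly (l j) t\<^sub>0 * (poly T (y j) - \<phi> (y j))\<bar>)" by (rule sum_abs)
  also have "\<dots> \<le> (\<Sum>j<m. M / real n ^ k * (\<bar>poly (l j) t\<^sub>0\<bar> * (1 + real n * \<bar>t\<^sub>0 - y j\<bar>) ^ k))"
  proof (rule sum_mono)
    fix j assume "j \<in> {..<m}"
    then have "\<bar>y j\<bar> \<le> 2 * R" using L unfolding localized_interpolant_def by simp
    then have "\<bar>poly T (y j) - \<phi> (y j)\<bar> \<le> M * \<bar>y j - t\<^sub>0\<bar> ^ k" using M(1)[of "y j"] by (simp add: abs_minus_commute)
    also have "\<dots> = M / real n ^ k * (real n * \<bar>t\<^sub>0 - y j\<bar>) ^ k"
      using n by (simp add: power_mult_distrib abs_minus_commute)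
    also have "\<dots> \<le> M / real n ^ k * (1 + real n * \<bar>t\<^sub>0 - y j\<bar>) ^ k"
      using M(2) by (intro mult_left_mono power_mono) auto
    finally have "\<bar>poly (l j) t\<^sub>0\<bar> * \<bar>poly T (y j) - \<phi> (y j)\<bar> \<le>
        \<bar>poly (l j) t\<^sub>0\<bar> * (M / real n ^ k * (1 + real n * \<bar>t\<^sub>0 - y j\<bar>) ^ k)" by (rule mult_left_mono) simp
    then show "\<bar>poly (l j) t\<^sub>0 * (poly T (y j) - \<phi> (y j))\<bar> \<le>
        M / real n ^ k * (\<bar>poly (l j) t\<^sub>0\<bar> * (1 + real n * \<bar>t\<^sub>0 - y j\<bar>) ^ k)" by (simp add: abs_mult mult_ac)
  qed
  also have "\<dots> = M / real n ^ k * (\<Sum>j<m. \<bar>poly (l j) t\<^sub>0\<bar> * (1 + real n * \<bar>t\<^sub>0 - y j\<bar>) ^ k)"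
    by (simp add: sum_distrib_left)
  also have "\<dots> \<le> M / real n ^ k * C"
    using L M(2) unfolding localized_interpolant_def by (intro mult_left_mono) auto
  finally show ?thesis by simp
qed

section \<open>Tensor products of the one-dimensional interpolants\<close>

definition nodes_subst :: "'d set \<Rightarrow> (nat \<Rightarrow> real) \<Rightarrow> ('d \<Rightarrow> nat) \<Rightarrow> real ^ 'd::finite \<Rightarrow> real ^ 'd" where
  "nodes_subst S y j x = (\<chi> i. if i \<in> S then y (j i) else x $ i)"

definition tensor_interpolant ::
    "'d set \<Rightarrow> nat \<Rightarrow> (nat \<Rightarrow> real) \<Rightarrow> (nat \<Rightarrow> real poly) \<Rightarrow> (real ^ 'd::finite \<Rightarrow> real) \<Rightarrow> real ^ 'd \<Rightarrow> real" where
  "tensor_interpolant S m y l g x =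
     (\<Sum>j\<in>S \<rightarrow>\<^sub>E {..<m}. (\<Prod>i\<in>S. poly (l (j i)) (x $ i)) * g (nodes_subst S y j x))"

lemma sum_PiE_insert:
  assumes "a \<notin> S"
  shows "(\<Sum>j\<in>insert a S \<rightarrow>\<^sub>E A. F j) = (\<Sum>j\<in>S \<rightarrow>\<^sub>E A. \<Sum>b\<in>A. F (j(a := b)))"
proof -
  have "(\<Sum>j\<in>insert a S \<rightarrow>\<^sub>E A. F j) = (\<Sum>p\<in>A \<times> (S \<rightarrow>\<^sub>E A). F (case p of (b, j) \<Rightarrow> j(a := b)))"
    unfolding PiE_insert_eq using inj_combinator[OF assms, of "\<lambda>_. A"] by (subst sum.reindex) (simp_all add: o_def)
  also have "\<dots> = (\<Sum>b\<in>A. \<Sum>j\<in>S \<rightarrow>\<^sub>E A. F (j(a := b)))"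
    by (simp add: sum.cartesian_product split_def)
  also have "\<dots> = (\<Sum>j\<in>S \<rightarrow>\<^sub>E A. \<Sum>b\<in>A. F (j(a := b)))" by (rule sum.swap)
  finally show ?thesis .
qed

lemma tensor_interpolant_insert:
  assumes "a \<notin> S"
  shows "tensor_interpolant (insert a S) m y l g x =
    tensor_interpolant S m y l (\<lambda>z. \<Sum>b<m. poly (l b) (z $ a) * g (coord_upd z a (y b))) x"
proof -
  have "(\<Prod>i\<in>insert a S. poly (l ((j(a := b)) i)) (x $ i)) = poly (l b) (x $ a) * (\<Prod>i\<in>S. poly (l (j i)) (x $ i))" for j b
  proof -
    have "(\<Prod>i\<in>S. poly (l ((j(a := b)) i)) (x $ i)) = (\<Prod>i\<in>S. poly (l (j i)) (x $ i))"
      using assms by (intro prod.cong) auto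
    then show ?thesis using assms by simp
  qed
  moreover have "nodes_subst (insert a S) y (j(a := b)) x = coord_upd (nodes_subst S y j x) a (y b)" for j b
    by (auto simp: vec_eq_iff nodes_subst_def coord_upd_nth)
  moreover have "nodes_subst S y j x $ a = x $ a" for j using assms by (simp add: nodes_subst_def)
  ultimately show ?thesis unfolding tensor_interpolant_def sum_PiE_insert[OF assms]
    by (simp add: sum_distrib_left mult_ac)
qed

text \<open>Coordinates are added one at a time. The new error is taken at points whose coordinates
  in S are already nodes, possibly far from x, so \<open>err\<close> lets it grow with the distance
  in these coordinates. The weighted sums of the earlier coordinates absorb that growth at the price
  of one factor C each.\<close>

lemma tensor_interpolant_error:
  fixes g :: "real ^ 'd::finite \<Rightarrow> real" and x :: "real ^ 'd"
  assumes L: "localized_interpolant k n R C m y l" and x: "\<And>i. \<bar>x $ i\<bar> \<le> R" and E: "E \<ge> 0" and C: "C \<ge> 1"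
    and err: "\<And>a S z. \<lbrakk>a \<notin> S; \<And>i. i \<notin> S \<Longrightarrow> z $ i = x $ i\<rbrakk> \<Longrightarrow>
      \<bar>g z - (\<Sum>b<m. poly (l b) (z $ a) * g (coord_upd z a (y b)))\<bar> \<le> E * (\<Prod>i\<in>S. (1 + real n * \<bar>x $ i - z $ i\<bar>) ^ k)"
  shows "\<bar>g x - tensor_interpolant S m y l g x\<bar> \<le> real (card S) * C ^ card S * E"
proof -
  have "finite S" by simp
  then show ?thesis
  proof (induction S)
    case empty
    have "nodes_subst {} y j x = x" for j by (simp add: nodes_subst_def vec_eq_iff)
    then show ?case by (simp add: tensor_interpolant_def)
  next
    case (insert a S)
    define e where "e = (\<lambda>z. g z - (\<Sum>b<m. poly (l b) (z $ a) * g (coord_upd z a (y b))))"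
    let ?w = "\<lambda>j i. \<bar>poly (l (j i)) (x $ i)\<bar> * (1 + real n * \<bar>x $ i - y (j i)\<bar>) ^ k"
    have "\<bar>tensor_interpolant S m y l g x - tensor_interpolant (insert a S) m y l g x\<bar> =
      \<bar>\<Sum>j\<in>S \<rightarrow>\<^sub>E {..<m}. (\<Prod>i\<in>S. poly (l (j i)) (x $ i)) * e (nodes_subst S y j x)\<bar>"
    proof -
      have "tensor_interpolant (insert a S) m y l g x =
          (\<Sum>j\<in>S \<rightarrow>\<^sub>E {..<m}. (\<Prod>i\<in>S. poly (l (j i)) (x $ i)) * (g (nodes_subst S y j x) - e (nodes_subst S y j x)))"
        unfolding tensor_interpolant_insert[OF insert(2)] by (simp add: tensor_interpolant_def e_def)
      then show ?thesis by (simp add: tensor_interpolant_def sum_subtractf right_diff_distrib)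
    qed
    also have "\<dots> \<le> (\<Sum>j\<in>S \<rightarrow>\<^sub>E {..<m}. \<bar>(\<Prod>i\<in>S. poly (l (j i)) (x $ i)) * e (nodes_subst S y j x)\<bar>)"
      by (rule sum_abs)
    also have "\<dots> \<le> (\<Sum>j\<in>S \<rightarrow>\<^sub>E {..<m}. E * (\<Prod>i\<in>S. ?w j i))"
    proof (rule sum_mono)
      fix j
      have "\<bar>e (nodes_subst S y j x)\<bar> \<le> E * (\<Prod>i\<in>S. (1 + real n * \<bar>x $ i - nodes_subst S y j x $ i\<bar>) ^ k)"
        unfolding e_def by (rule err) (use insert(2) in \<open>auto simp: nodes_subst_def\<close>)
      also have "(\<Prod>i\<in>S. (1 + real n * \<bar>x $ i - nodes_subst S y j x $ i\<bar>) ^ k) = (\<Prod>i\<in>S. (1 + real n * \<bar>x $ i - y (j i)\<bar>) ^ k)"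
        by (intro prod.cong) (auto simp: nodes_subst_def)
      finally have "(\<Prod>i\<in>S. \<bar>poly (l (j i)) (x $ i)\<bar>) * \<bar>e (nodes_subst S y j x)\<bar> \<le>
        (\<Prod>i\<in>S. \<bar>poly (l (j i)) (x $ i)\<bar>) * (E * (\<Prod>i\<in>S. (1 + real n * \<bar>x $ i - y (j i)\<bar>) ^ k))"
        by (intro mult_left_mono prod_nonneg) auto
      then show "\<bar>(\<Prod>i\<in>S. poly (l (j i)) (x $ i)) * e (nodes_subst S y j x)\<bar> \<le> E * (\<Prod>i\<in>S. ?w j i)"
        by (simp add: abs_mult abs_prod prod.distrib mult_ac)
    qed
    also have "\<dots> = E * (\<Prod>i\<in>S. \<Sum>b<m. \<bar>poly (l b) (x $ i)\<bar> * (1 + real n * \<bar>x $ i - y b\<bar>) ^ k)"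
      by (subst prod_sum_PiE) (simp_all add: sum_distrib_left)
    also have "\<dots> \<le> E * (\<Prod>i\<in>S. C)"
      using L x unfolding localized_interpolant_def
      by (intro mult_left_mono prod_mono E conjI sum_nonneg) auto
    also have "\<dots> = C ^ card S * E" by simp
    finally have "\<bar>g x - tensor_interpolant (insert a S) m y l g x\<bar> \<le> real (card S) * C ^ card S * E + C ^ card S * E"
      using insert.IH by linarith
    also have "\<dots> = (real (card S) + 1) * (C ^ card S * E)" by (simp add: algebra_simps)
    also have "\<dots> \<le> (real (card S) + 1) * (C ^ Suc (card S) * E)"
      using C E by (intro mult_left_mono mult_right_mono power_increasing) auto
    finally show ?case using insert(1,2) by (simp add: add.commute mult.assoc)
  qed
qed

lemma tensor_interpolant_total_degree:
  assumes "localized_interpolant k n R C m y l"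
  shows "(tensor_interpolant UNIV m y l g :: real ^ 'd::finite \<Rightarrow> real) \<in> total_degree_polys (CARD('d) * n)"
proof -
  have eq: "tensor_interpolant UNIV m y l g = (\<lambda>x. \<Sum>j\<in>UNIV \<rightarrow>\<^sub>E {..<m}. g (\<chi> i. y (j i)) * (\<Prod>i\<in>UNIV. poly (l (j i)) (x $ i)))"
    by (simp add: tensor_interpolant_def nodes_subst_def fun_eq_iff mult.commute)
  show ?thesis unfolding eq
  proof (intro sum_total_degree scale_total_degree prod_total_degree)
    fix j :: "'d \<Rightarrow> nat" assume j: "j \<in> UNIV \<rightarrow>\<^sub>E {..<m}"
    have "(\<Sum>i\<in>(UNIV :: 'd set). degree (l (j i))) \<le> (\<Sum>i\<in>(UNIV :: 'd set). n)"
      using assms j unfolding localized_interpolant_def by (intro sum_mono) (auto simp: PiE_iff)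
    then show "(\<Sum>i\<in>UNIV. degree (l (j i))) \<le> CARD('d) * n" by simp
  qed
qed

lemma total_degree_polys_mono:
  assumes "p \<in> total_degree_polys m" "m \<le> n"
  shows "p \<in> total_degree_polys n"
proof -
  obtain c where "p = (\<lambda>x. \<Sum>\<alpha> | sum \<alpha> UNIV \<le> m. c \<alpha> * (\<Prod>r\<in>UNIV. (x $ r) ^ \<alpha> r))"
    using assms(1) unfolding total_degree_polys_def by blast
  then show ?thesis using assms(2)
    by (auto intro!: sum_total_degree scale_total_degree monomial_total_degree)
qed

lemma localized_interpolant_const_ge_1:
  assumes L: "localized_interpolant k n R C m y l" and "R \<ge> 0"
  shows "C \<ge> 1"
proof -
  have "(\<Sum>j<m. poly (l j) 0 * poly 1 (y j)) = poly 1 0"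
    using L unfolding localized_interpolant_def by (metis degree_1 zero_le)
  then have "1 = (\<Sum>j<m. poly (l j) 0)" by simp
  also have "\<dots> \<le> (\<Sum>j<m. \<bar>poly (l j) 0\<bar>)" by (intro sum_mono) auto
  also have "\<dots> \<le> C" using localized_interpolant_abs_sum[OF L, of 0] assms by simp
  finally show ?thesis .
qed

text \<open>The cut-off may jump at the border of V and the bound still holds on the whole segment
  |t| \<le> 2 R. Within \<rho> it is Taylor's formula; beyond \<rho> both g and T are bounded, and
  dividing by \<rho>^k turns that constant into a multiple of |t - z $ a|^k.\<close>

lemma taylor_along_axis:
  fixes D :: "('d::finite \<Rightarrow> nat) \<Rightarrow> real ^ 'd \<Rightarrow> real" and z :: "real ^ 'd"
  assumes k: "k > 0" and D: "\<And>\<gamma> i x. \<lbrakk>sum \<gamma> UNIV < k; x \<in> U\<rbrakk> \<Longrightarrow>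
      ((\<lambda>t. D \<gamma> (x + t *\<^sub>R axis i 1)) has_real_derivative D (\<gamma>(i := Suc (\<gamma> i))) x) (at 0)"
    and V: "V \<subseteq> U" and M: "\<And>x j. \<lbrakk>x \<in> V; j \<le> k\<rbrakk> \<Longrightarrow> \<bar>D ((\<lambda>_. 0)(a := j)) x\<bar> \<le> M" "M \<ge> 0"
    and \<rho>: "\<rho> > 0" "\<And>t. \<bar>t - z $ a\<bar> \<le> \<rho> \<Longrightarrow> coord_upd z a t \<in> V"
    and R: "\<bar>z $ a\<bar> \<le> R" and g: "g = (\<lambda>x. if x \<in> V then D (\<lambda>_. 0) x else 0)"
  shows "\<exists>T. degree T \<le> k \<and> poly T (z $ a) = g z \<and> (\<forall>t. \<bar>t\<bar> \<le> 2 * R \<longrightarrow> \<bar>g (coord_upd z a t) - poly T t\<bar> \<le>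
       (M + (M + real k * (M * (1 + 3 * R) ^ k)) / \<rho> ^ k) * \<bar>t - z $ a\<bar> ^ k)"
proof -
  define d where "d = (\<lambda>j t. D ((\<lambda>_. 0)(a := j)) (coord_upd z a t))"
  define t\<^sub>0 where "t\<^sub>0 = z $ a"
  \<comment> \<open>The sum stops below k, so that the Lagrange remainder involves the derivative of
    order k, the last one provided.\<close>
  define T where "T = (\<Sum>i<k. smult (d i t\<^sub>0 / fact i) ([:- t\<^sub>0, 1:] ^ i))"
  have T: "poly T t = (\<Sum>i<k. d i t\<^sub>0 / fact i * (t - t\<^sub>0) ^ i)" for t
    by (simp add: T_def poly_sum)
  have dM: "\<bar>d j t\<bar> \<le> M" if "j \<le> k" "\<bar>t - t\<^sub>0\<bar> \<le> \<rho>" for j t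
    unfolding d_def using that \<rho>(2) by (intro M) (auto simp: t\<^sub>0_def)
  have R0: "R \<ge> 0" using R by linarith
  have g_bound: "\<bar>g x\<bar> \<le> M" for x using M(1)[of x 0] M(2) by (simp add: g fun_upd_def)
  have d0: "d 0 t = D (\<lambda>_. 0) (coord_upd z a t)" for t by (simp add: d_def fun_upd_def)
  have zV: "z \<in> V" using \<rho>(2)[of "z $ a"] \<rho>(1) by (simp add: coord_upd_self)
  show ?thesis
  proof (intro exI[of _ T] conjI allI impI)
    show "degree T \<le> k" unfolding T_def
    proof (intro degree_sum_le)
      fix i assume "i \<in> {..<k}"
      moreover have "degree ([:- t\<^sub>0, 1:] ^ i) \<le> 1 * i" using degree_power_le[of "[:- t\<^sub>0, 1:]" i] by simp
      ultimately show "degree (smult (d i t\<^sub>0 / fact i) ([:- t\<^sub>0, 1:] ^ i)) \<le> k"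
        by (intro order_trans[OF degree_smult_le]) auto
    qed simp
    have "poly T t\<^sub>0 = (\<Sum>i<k. if i = 0 then d 0 t\<^sub>0 else 0)" unfolding T by (intro sum.cong) auto
    then show "poly T (z $ a) = g z" using k zV by (simp add: t\<^sub>0_def d0 g coord_upd_self)
    fix t assume t: "\<bar>t\<bar> \<le> 2 * R"
    define K where "K = M + real k * (M * (1 + 3 * R) ^ k)"
    have K0: "K \<ge> 0" using M R0 by (simp add: K_def)
    have "\<bar>g (coord_upd z a t) - poly T t\<bar> \<le> (M + K / \<rho> ^ k) * \<bar>t - t\<^sub>0\<bar> ^ k"
    proof (cases "\<bar>t - t\<^sub>0\<bar> \<le> \<rho>")
      case True
      have gt: "g (coord_upd z a t) = d 0 t" using \<rho>(2)[of t] True by (simp add: g d0 t\<^sub>0_def)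
      have "\<bar>g (coord_upd z a t) - poly T t\<bar> \<le> M * \<bar>t - t\<^sub>0\<bar> ^ k"
      proof (cases "t = t\<^sub>0")
        case True
        have "g (coord_upd z a t) = poly T t"
          using \<open>poly T (z $ a) = g z\<close> unfolding True t\<^sub>0_def coord_upd_self by simp
        then show ?thesis using M(2) by simp
      next
        case False
        have "\<forall>j s. j < k \<and> t\<^sub>0 - \<rho> \<le> s \<and> s \<le> t\<^sub>0 + \<rho> \<longrightarrow> DERIV (d j) s :> d (Suc j) s"
        proof (intro allI impI)
          fix j s assume js: "j < k \<and> t\<^sub>0 - \<rho> \<le> s \<and> s \<le> t\<^sub>0 + \<rho>"
          then have "coord_upd z a s \<in> U" using \<rho>(2)[of s] V by (auto simp: t\<^sub>0_def abs_le_iff)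
          moreover have "sum ((\<lambda>_. 0)(a := j)) UNIV < k" using js by (simp add: fun_upd_def)
          ultimately have "((\<lambda>h. D ((\<lambda>_. 0)(a := j)) (coord_upd z a s + h *\<^sub>R axis a 1)) has_real_derivative
            D (((\<lambda>_. 0)(a := j))(a := Suc (((\<lambda>_. 0)(a := j)) a))) (coord_upd z a s)) (at 0)" by (intro D)
          then have "((\<lambda>h. d j (h + s)) has_real_derivative d (Suc j) s) (at 0)"
            by (simp add: coord_upd_add d_def add.commute)
          then show "DERIV (d j) s :> d (Suc j) s" using DERIV_shift[of "d j" "d (Suc j) s" 0 s] by simp
        qed
        from Taylor[OF k refl this, of t\<^sub>0 t] obtain s where
          s: "if t < t\<^sub>0 then t < s \<and> s < t\<^sub>0 else t\<^sub>0 < s \<and> s < t"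
          "d 0 t = (\<Sum>i<k. d i t\<^sub>0 / fact i * (t - t\<^sub>0) ^ i) + d k s / fact k * (t - t\<^sub>0) ^ k"
          using False True \<rho>(1) by (auto simp: abs_le_iff)
        have "\<bar>d k s\<bar> \<le> M" using s(1) True by (intro dM) (auto split: if_splits)
        then have "\<bar>d k s / fact k\<bar> \<le> M / 1" unfolding abs_divide using M(2)
          by (intro frac_le) (auto simp: fact_ge_1)
        then have "\<bar>d k s / fact k * (t - t\<^sub>0) ^ k\<bar> \<le> M * \<bar>t - t\<^sub>0\<bar> ^ k"
          unfolding abs_mult power_abs by (intro mult_right_mono) auto
        then show ?thesis unfolding gt T s(2) by simp
      qed
      also have "\<dots> \<le> (M + K / \<rho> ^ k) * \<bar>t - t\<^sub>0\<bar> ^ k" using K0 \<rho> by (intro mult_right_mono) auto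
      finally show ?thesis .
    next
      case False
      have t3: "\<bar>t - t\<^sub>0\<bar> \<le> 3 * R" using t R unfolding t\<^sub>0_def by linarith
      have "\<bar>poly T t\<bar> \<le> (\<Sum>i<k. \<bar>d i t\<^sub>0 / fact i * (t - t\<^sub>0) ^ i\<bar>)" unfolding T by (rule sum_abs)
      also have "\<dots> \<le> (\<Sum>i<k. M * (1 + 3 * R) ^ k)"
      proof (rule sum_mono)
        fix i assume i: "i \<in> {..<k}"
        have "\<bar>d i t\<^sub>0 / fact i\<bar> \<le> M / 1" unfolding abs_divide using dM[of i t\<^sub>0] i \<rho>(1) M(2)
          by (intro frac_le) (auto simp: fact_ge_1)
        moreover have "\<bar>t - t\<^sub>0\<bar> ^ i \<le> (1 + 3 * R) ^ k"
        proof -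
          have "\<bar>t - t\<^sub>0\<bar> ^ i \<le> (1 + 3 * R) ^ i" using t3 by (intro power_mono) auto
          also have "\<dots> \<le> (1 + 3 * R) ^ k" using i R0 by (intro power_increasing) auto
          finally show ?thesis .
        qed
        ultimately show "\<bar>d i t\<^sub>0 / fact i * (t - t\<^sub>0) ^ i\<bar> \<le> M * (1 + 3 * R) ^ k"
          unfolding abs_mult power_abs using M(2) by (intro mult_mono) auto
      qed
      finally have "\<bar>g (coord_upd z a t) - poly T t\<bar> \<le> K" unfolding K_def
        using g_bound[of "coord_upd z a t"] by simp
      also have "\<dots> = K / \<rho> ^ k * \<rho> ^ k" using \<rho> by simp
      also have "\<dots> \<le> K / \<rho> ^ k * \<bar>t - t\<^sub>0\<bar> ^ k" using False \<rho> K0 by (intro mult_left_mono power_mono) auto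
      also have "\<dots> \<le> (M + K / \<rho> ^ k) * \<bar>t - t\<^sub>0\<bar> ^ k" using M(2) by (intro mult_right_mono) auto
      finally show ?thesis .
    qed
    then show "\<bar>g (coord_upd z a t) - poly T t\<bar> \<le>
       (M + (M + real k * (M * (1 + 3 * R) ^ k)) / \<rho> ^ k) * \<bar>t - z $ a\<bar> ^ k" by (simp add: K_def t\<^sub>0_def)
  qed
qed

theorem jackson_total_degree:
  fixes \<Omega> :: "(real ^ 'd::finite) set"
  assumes \<Omega>: "compact \<Omega>" and f: "continuously_differentiable_to_order k \<Omega> f"
  shows "\<exists>C n0. \<forall>n\<ge>n0. \<exists>p \<in> total_degree_polys n. \<forall>x\<in>\<Omega>. \<bar>f x - p x\<bar> \<le> C / real n ^ k"
proof -
  obtain U and D :: "('d \<Rightarrow> nat) \<Rightarrow> real ^ 'd \<Rightarrow> real" where U: "open U" "\<Omega> \<subseteq> U"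
    and Df: "\<And>x. x \<in> \<Omega> \<Longrightarrow> D (\<lambda>_. 0) x = f x"
    and Dc: "\<And>\<gamma>. sum \<gamma> UNIV \<le> k \<Longrightarrow> continuous_on U (D \<gamma>)"
    and DD: "\<And>\<gamma> i x. \<lbrakk>sum \<gamma> UNIV < k; x \<in> U\<rbrakk> \<Longrightarrow>
      ((\<lambda>t. D \<gamma> (x + t *\<^sub>R axis i 1)) has_real_derivative D (\<gamma>(i := Suc (\<gamma> i))) x) (at 0)"
    using f unfolding continuously_differentiable_to_order_def by metis
  show ?thesis
  proof (cases "k = 0")
    case True
    have "continuous_on \<Omega> (D (\<lambda>_. 0))" using Dc[of "\<lambda>_. 0"] U continuous_on_subset by auto
    then have "bounded (D (\<lambda>_. 0) ` \<Omega>)" using \<Omega> compact_continuous_image compact_imp_bounded by blast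
    then obtain C where "\<And>x. x \<in> \<Omega> \<Longrightarrow> \<bar>D (\<lambda>_. 0) x\<bar> \<le> C" by (auto simp: bounded_iff)
    then have "\<bar>f x - 0\<bar> \<le> C / real n ^ k" if "x \<in> \<Omega>" for x n using that Df True by simp
    then show ?thesis by (intro exI[of _ C] exI[of _ 0] allI impI bexI[OF _ zero_total_degree] ballI)
  next
    case False
    then have k: "k > 0" by simp
    obtain e where e: "e > 0" "(\<Union>x\<in>\<Omega>. cball x e) \<subseteq> U"
      using compact_subset_open_imp_cball_epsilon_subset[OF \<Omega> U] by blast
    define V where "V = (\<Union>x\<in>\<Omega>. cball x e)"
    have V: "compact V" "V \<subseteq> U" using compact_minkowski_sum_cball[OF \<Omega>] e by (auto simp: V_def)
    have "bounded (\<Union>a\<in>UNIV. \<Union>j\<in>{..k}. D ((\<lambda>_. 0)(a := j)) ` V)"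
    proof (intro bounded_UN finite finite_atMost ballI)
      fix a :: 'd and j assume "j \<in> {..k}"
      then have "sum ((\<lambda>_. 0)(a := j)) UNIV \<le> k" by (simp add: fun_upd_def)
      then show "bounded (D ((\<lambda>_. 0)(a := j)) ` V)"
        using Dc V by (meson compact_continuous_image compact_imp_bounded continuous_on_subset)
    qed
    then obtain M where "M > 0" and M: "\<And>a j x. \<lbrakk>x \<in> V; j \<le> k\<rbrakk> \<Longrightarrow> \<bar>D ((\<lambda>_. 0)(a := j)) x\<bar> \<le> M"
      unfolding bounded_pos by fastforce
    obtain R where R: "R > 0" "\<And>x. x \<in> \<Omega> \<Longrightarrow> norm x \<le> R"
      using compact_imp_bounded[OF \<Omega>] unfolding bounded_pos by blast
    have xR: "\<bar>x $ i\<bar> \<le> R" if "x \<in> \<Omega>" for x i using R(2)[OF that] component_le_norm_cart[of x i] by linarith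
    obtain C where C: "C > 0" and interp: "\<And>n. n \<ge> k \<Longrightarrow> \<exists>m y l. localized_interpolant k n R C m y l"
      using localized_interpolation[OF R(1), of k] by blast
    define g where "g = (\<lambda>x. if x \<in> V then D (\<lambda>_. 0) x else 0)"
    have gM: "\<bar>g x\<bar> \<le> M" for x using M[of x 0] \<open>M > 0\<close> by (simp add: g_def fun_upd_def)
    have gf: "g x = f x" if "x \<in> \<Omega>" for x using that Df e(1) by (force simp: g_def V_def)
    \<comment> \<open>Half of e is reserved for the distance from x to z, the other half for moving
      along one axis. By the sum norm, coordinates within \<sigma> keep z within \<rho> of
      x.\<close>
    define \<rho> where "\<rho> = e / 2"
    define \<sigma> where "\<sigma> = \<rho> / real CARD('d)"
    have \<rho>: "\<rho> > 0" "\<sigma> > 0" using e by (auto simp: \<rho>_def \<sigma>_def)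
    define K where "K = M + (M + real k * (M * (1 + 3 * R) ^ k)) / \<rho> ^ k"
    have K: "K \<ge> 0" using \<open>M > 0\<close> R \<rho> by (simp add: K_def)
    \<comment> \<open>One term per case: z close to x, where Taylor's formula applies, and z far
      from x in some coordinate, where only the boundedness of g is used.\<close>
    define E where "E = K * C + (M + C * M) / \<sigma> ^ k"
    have E: "E \<ge> K * C" "E \<ge> (M + C * M) / \<sigma> ^ k" "E \<ge> 0" using K C \<open>M > 0\<close> \<rho> by (auto simp: E_def)
    have main: "\<exists>p \<in> total_degree_polys (CARD('d) * n). \<forall>x\<in>\<Omega>. \<bar>f x - p x\<bar> \<le> real CARD('d) * C ^ CARD('d) * (E / real n ^ k)"
      if n: "n \<ge> k" for n
    proof -
      have n0: "n > 0" using n k by simp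
      obtain m y l where L: "localized_interpolant k n R C m y l" using interp[OF n] by blast
      have C1: "C \<ge> 1" using localized_interpolant_const_ge_1[OF L] R by simp
      have "\<bar>f x - tensor_interpolant UNIV m y l g x\<bar> \<le> real CARD('d) * C ^ CARD('d) * (E / real n ^ k)"
        if x: "x \<in> \<Omega>" for x
        unfolding gf[OF x, symmetric]
      proof (rule tensor_interpolant_error[OF L xR[OF x] _ C1])
        show "0 \<le> E / real n ^ k" using E by simp
        fix a S z assume a: "a \<notin> S" and z: "\<And>i. i \<notin> S \<Longrightarrow> z $ i = x $ i"
        define P where "P = (\<Prod>i\<in>S. (1 + real n * \<bar>x $ i - z $ i\<bar>) ^ k)"
        have zR: "\<bar>z $ a\<bar> \<le> R" using xR[OF x] z[OF a] by simp
        show "\<bar>g z - (\<Sum>b<m. poly (l b) (z $ a) * g (coord_upd z a (y b)))\<bar> \<le> E / real n ^ k * (\<Prod>i\<in>S. (1 + real n * \<bar>x $ i - z $ i\<bar>) ^ k)"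
        proof (cases "\<forall>i. \<bar>x $ i - z $ i\<bar> \<le> \<sigma>")
          case True
          have "dist x z \<le> (\<Sum>i\<in>UNIV. \<bar>x $ i - z $ i\<bar>)" using norm_le_l1_cart[of "x - z"] by (simp add: dist_norm)
          also have "\<dots> \<le> real CARD('d) * \<sigma>" using sum_bounded_above[of UNIV "\<lambda>i. \<bar>x $ i - z $ i\<bar>" \<sigma>] True by simp
          finally have "dist x z \<le> \<rho>" by (simp add: \<sigma>_def)
          have zV: "coord_upd z a t \<in> V" if "\<bar>t - z $ a\<bar> \<le> \<rho>" for t
          proof -
            have "dist x (coord_upd z a t) \<le> dist x z + dist z (coord_upd z a t)" by (rule dist_triangle)
            also have "\<dots> \<le> e" using that \<open>dist x z \<le> \<rho>\<close> unfolding dist_coord_upd by (simp add: \<rho>_def)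
            finally show ?thesis using x by (auto simp: V_def)
          qed
          have "\<exists>T. degree T \<le> k \<and> poly T (z $ a) = g z \<and>
              (\<forall>t. \<bar>t\<bar> \<le> 2 * R \<longrightarrow> \<bar>g (coord_upd z a t) - poly T t\<bar> \<le> K * \<bar>t - z $ a\<bar> ^ k)"
            by (rule taylor_along_axis[where D = D and U = U and V = V and k = k and M = M and \<rho> = \<rho>
                and z = z and a = a and R = R and g = g, folded K_def])
              (fact k DD V(2) M less_imp_le[OF \<open>M > 0\<close>] \<rho>(1) zV zR g_def)+
          then obtain T where T: "degree T \<le> k" "poly T (z $ a) = g z"
            "\<And>t. \<bar>t\<bar> \<le> 2 * R \<Longrightarrow> \<bar>g (coord_upd z a t) - poly T t\<bar> \<le> K * \<bar>t - z $ a\<bar> ^ k" by blast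
          have "\<bar>g z - (\<Sum>b<m. poly (l b) (z $ a) * g (coord_upd z a (y b)))\<bar> \<le> K * C / real n ^ k"
            using localized_interpolant_error[OF L zR n0 T(1), of "\<lambda>t. g (coord_upd z a t)" K] T K
            by (simp add: coord_upd_self)
          also have "\<dots> \<le> E / real n ^ k * 1" using E by (simp add: divide_right_mono)
          also have "\<dots> \<le> E / real n ^ k * P" unfolding P_def using E
            by (intro mult_left_mono prod_ge_1 one_le_power) auto
          finally show ?thesis unfolding P_def .
        next
          case False
          then obtain i where i: "\<bar>x $ i - z $ i\<bar> > \<sigma>" by (auto simp: not_le)
          \<comment> \<open>Coordinates outside S agree with those of x, so the distant one carries
            a weight. That weight is at least (n \<sigma>)^k and supplies the missing power of
            n.\<close>
          then have iS: "i \<in> S" using z[of i] \<rho> by (cases "i \<in> S") auto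
          have "\<bar>\<Sum>b<m. poly (l b) (z $ a) * g (coord_upd z a (y b))\<bar> \<le> (\<Sum>b<m. \<bar>poly (l b) (z $ a) * g (coord_upd z a (y b))\<bar>)"
            by (rule sum_abs)
          also have "\<dots> \<le> (\<Sum>b<m. \<bar>poly (l b) (z $ a)\<bar> * M)"
            unfolding abs_mult using gM by (intro sum_mono mult_left_mono) auto
          also have "\<dots> \<le> C * M" unfolding sum_distrib_right[symmetric]
            using localized_interpolant_abs_sum[OF L zR] \<open>M > 0\<close> by (intro mult_right_mono) auto
          finally have "\<bar>g z - (\<Sum>b<m. poly (l b) (z $ a) * g (coord_upd z a (y b)))\<bar> \<le> M + C * M"
            using gM[of z] by linarith
          also have "\<dots> = (M + C * M) / \<sigma> ^ k / real n ^ k * (real n * \<sigma>) ^ k"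
            using n0 \<rho> by (simp add: power_mult_distrib)
          also have "\<dots> \<le> E / real n ^ k * P"
          proof (intro mult_mono divide_right_mono E)
            have "real n * \<sigma> \<le> 1 + real n * \<bar>x $ i - z $ i\<bar>" using mult_left_mono[of \<sigma> "\<bar>x $ i - z $ i\<bar>" "real n"] i by simp
            then have "(real n * \<sigma>) ^ k \<le> (1 + real n * \<bar>x $ i - z $ i\<bar>) ^ k" using \<rho> by (intro power_mono) auto
            also have "\<dots> = (\<Prod>i\<in>{i}. (1 + real n * \<bar>x $ i - z $ i\<bar>) ^ k)" by simp
            also have "\<dots> \<le> P" unfolding P_def using iS by (intro prod_mono2) (auto intro: one_le_power)
            finally show "(real n * \<sigma>) ^ k \<le> P" .
          qed (use E \<rho> in auto)
          finally show ?thesis unfolding P_def .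
        qed
      qed
      then show ?thesis using tensor_interpolant_total_degree[OF L, of g] by blast
    qed
    define A where "A = real CARD('d) * C ^ CARD('d) * E * (2 * real CARD('d)) ^ k"
    have "\<exists>p \<in> total_degree_polys n. \<forall>x\<in>\<Omega>. \<bar>f x - p x\<bar> \<le> A / real n ^ k" if n: "n \<ge> CARD('d) * k" for n
    proof -
      \<comment> \<open>Degrees add up over the coordinates, so each coordinate gets only n div d,
        where d is the dimension. Since n \<le> 2 d n', this costs the factor (2 d)^k.\<close>
      define n' where "n' = n div CARD('d)"
      have d: "CARD('d) > 0" by simp
      have n': "n' \<ge> k" using n unfolding n'_def by (simp add: less_eq_div_iff_mult_less_eq mult.commute)
      then have n'1: "n' \<ge> 1" using k by linarith
      have le: "CARD('d) * n' \<le> n" by (simp add: n'_def)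
      obtain p where p: "p \<in> total_degree_polys (CARD('d) * n')"
        "\<And>x. x \<in> \<Omega> \<Longrightarrow> \<bar>f x - p x\<bar> \<le> real CARD('d) * C ^ CARD('d) * (E / real n' ^ k)"
        using main[OF n'] by blast
      have "n > 0" using le n'1 d by (cases n) auto
      have "n < CARD('d) * (n' + 1)" unfolding n'_def
        using dividend_less_div_times[of "CARD('d)" n] by (simp add: algebra_simps)
      also have "\<dots> \<le> CARD('d) * (2 * n')" using n'1 by (intro mult_le_mono2) simp
      finally have "real n \<le> real (CARD('d) * (2 * n'))" by (simp only: of_nat_le_iff)
      then have "real n ^ k \<le> (2 * real CARD('d) * real n') ^ k" by (intro power_mono) auto
      then have "1 / real n' ^ k \<le> (2 * real CARD('d)) ^ k / real n ^ k"
        using n'1 \<open>n > 0\<close> by (simp add: field_simps power_mult_distrib)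
      then have "real CARD('d) * C ^ CARD('d) * E * (1 / real n' ^ k) \<le>
        real CARD('d) * C ^ CARD('d) * E * ((2 * real CARD('d)) ^ k / real n ^ k)"
        using C E by (intro mult_left_mono) auto
      then have "\<bar>f x - p x\<bar> \<le> A / real n ^ k" if "x \<in> \<Omega>" for x
        using p(2)[OF that] by (simp add: A_def)
      then show ?thesis using total_degree_polys_mono[OF p(1) le] by blast
    qed
    then show ?thesis by blast
  qed
qed

section \<open>Equispaced grids\<close>

text \<open>Exposes the spacing h, in terms of which the norming estimates are stated.\<close>

definition grid_discretization :: "(real ^ 'd::finite) set \<Rightarrow> real \<Rightarrow> (real ^ 'd) set \<Rightarrow> bool" where
  "grid_discretization \<Omega> h X \<longleftrightarrow> (\<exists>(a :: real ^ 'd) s m. 0 < s \<and> 0 < m \<and> h = s / real m \<and>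
     \<Omega> \<subseteq> cbox a (\<chi> i. a $ i + s) \<and>
     X = {x \<in> \<Omega>. \<exists>j :: 'd \<Rightarrow> nat. (\<forall>i. j i \<le> m) \<and> x = (\<chi> i. a $ i + real (j i) * (s / real m))})"

lemma equispaced_iff_grid:
  "equispaced_discretization \<Omega> X \<longleftrightarrow> (\<exists>h. grid_discretization \<Omega> h X)"
  unfolding equispaced_discretization_def grid_discretization_def by blast

lemma finite_grid:
  assumes "grid_discretization \<Omega> h (X :: (real ^ 'd::finite) set)"
  shows "finite X"
proof -
  obtain a :: "real ^ 'd" and s m where
    X: "X = {x \<in> \<Omega>. \<exists>j :: 'd \<Rightarrow> nat. (\<forall>i. j i \<le> m) \<and> x = (\<chi> i. a $ i + real (j i) * (s / real m))}"
    using assms unfolding grid_discretization_def by blast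
  have "X \<subseteq> (\<lambda>j. \<chi> i. a $ i + real (j i) * (s / real m)) ` (UNIV \<rightarrow>\<^sub>E {..m})"
    unfolding X by (auto simp: PiE_iff)
  then show ?thesis by (rule finite_subset) (simp add: finite_PiE)
qed

text \<open>In a union, the mesh condition at a point of one body may be met by a grid point of
  another, so it is used only to bound the spacing. Some point of the cube has a coordinate at
  distance at least \<open>\<mu>\<close> from all grid coordinates. The entry r / 2 in
  \<open>\<mu>\<close> keeps this point in the cube, and \<epsilon> < r / 2 rules it out as the
  minimum.\<close>

lemma grid_spacing_le:
  fixes \<Omega> X :: "(real ^ 'd::finite) set"
  assumes grid: "grid_discretization \<Omega> h X"
    and cube: "\<And>q. (\<And>i. \<bar>q $ i - b $ i\<bar> \<le> r) \<Longrightarrow> q \<in> \<Omega>" and r: "r > 0"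
    and X: "X \<noteq> {}" and mesh: "\<And>x. x \<in> \<Omega> \<Longrightarrow> (INF y\<in>X. infnorm (y - x)) \<le> \<epsilon>" and \<epsilon>: "\<epsilon> < r / 2"
  shows "h \<le> 4 * \<epsilon>"
proof -
  obtain a :: "real ^ 'd" and s m where s: "0 < s" "0 < m" "h = s / real m" and
    Xeq: "X = {x \<in> \<Omega>. \<exists>j :: 'd \<Rightarrow> nat. (\<forall>i. j i \<le> m) \<and> x = (\<chi> i. a $ i + real (j i) * (s / real m))}"
    using grid unfolding grid_discretization_def by blast
  have h: "h > 0" using s by simp
  define \<mu> where "\<mu> = min (h / 4) (r / 2)"
  have \<mu>: "\<mu> > 0" "4 * \<mu> \<le> h" "2 * \<mu> \<le> r" using h r by (auto simp: \<mu>_def)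
  \<comment> \<open>Any coordinate will do, since each one is dominated by the maximum norm.\<close>
  obtain i :: 'd where True by blast
  have "\<exists>t. \<bar>t\<bar> \<le> r \<and> (\<forall>j :: nat. \<bar>a $ i + real j * h - (b $ i + t)\<bar> \<ge> \<mu>)"
  proof (cases "\<forall>j :: nat. \<bar>a $ i + real j * h - b $ i\<bar> \<ge> \<mu>")
    case True
    then show ?thesis using r by (intro exI[of _ 0]) auto
  next
    case False
    \<comment> \<open>Here b is too close to a grid coordinate. The shift by 2 \<mu> moves at least
      \<mu> away from it and, as h \<ge> 4 \<mu>, does not come closer than \<mu> to the
      next.\<close>
    then obtain j where j: "\<bar>a $ i + real j * h - b $ i\<bar> < \<mu>" by (auto simp: not_le)
    have "\<bar>a $ i + real j' * h - (b $ i + 2 * \<mu>)\<bar> \<ge> \<mu>" for j' :: nat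
    proof (cases "j' \<le> j")
      case True
      then have "real j' * h \<le> real j * h" using h by simp
      then show ?thesis using j by linarith
    next
      case False
      then have "(real j + 1) * h \<le> real j' * h" using h by (intro mult_right_mono) auto
      then have "real j * h + h \<le> real j' * h" by (simp add: distrib_right)
      then show ?thesis using j \<mu> by linarith
    qed
    then show ?thesis using \<mu> by (intro exI[of _ "2 * \<mu>"]) auto
  qed
  then obtain t where t: "\<bar>t\<bar> \<le> r" "\<And>j :: nat. \<bar>a $ i + real j * h - (b $ i + t)\<bar> \<ge> \<mu>" by blast
  define x where "x = b + t *\<^sub>R axis i 1"
  have x\<Omega>: "x \<in> \<Omega>" by (rule cube) (use t(1) r in \<open>auto simp: x_def axis_def\<close>)
  have "\<mu> \<le> (INF y\<in>X. infnorm (y - x))"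
  proof (rule cINF_greatest[OF X])
    fix y assume "y \<in> X"
    then obtain j :: "'d \<Rightarrow> nat" where y: "y = (\<chi> i. a $ i + real (j i) * h)" unfolding Xeq s(3) by blast
    have "\<mu> \<le> \<bar>(y - x) $ i\<bar>" using t(2)[of "j i"] by (simp add: y x_def axis_def)
    also have "\<dots> \<le> infnorm (y - x)" by (rule component_le_infnorm_cart)
    finally show "\<mu> \<le> infnorm (y - x)" .
  qed
  then have "\<mu> \<le> \<epsilon>" using mesh[OF x\<Omega>] by linarith
  then show ?thesis using \<epsilon> by (auto simp: \<mu>_def min_def split: if_splits)
qed

text \<open>Contracting the cube around b towards z gives a cube of half-width \<sigma> r inside B,
  which is wide enough to contain a grid point.\<close>

lemma grid_point_towards_cube:
  fixes \<Omega> B X :: "(real ^ 'd::finite) set"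
  assumes grid: "grid_discretization \<Omega> h X" and B: "convex B" "B \<subseteq> \<Omega>" "z \<in> B"
    and cube: "\<And>q. (\<And>i. \<bar>q $ i - b $ i\<bar> \<le> r) \<Longrightarrow> q \<in> B"
    and \<sigma>: "0 < \<sigma>" "\<sigma> \<le> 1" "h \<le> \<sigma> * r"
  obtains y q where "y \<in> X" "\<And>i. \<bar>q $ i - b $ i\<bar> \<le> r" "y = z + \<sigma> *\<^sub>R (q - z)"
proof -
  obtain a :: "real ^ 'd" and s m where s: "0 < s" "0 < m" "h = s / real m" and box: "\<Omega> \<subseteq> cbox a (\<chi> i. a $ i + s)" and
    Xeq: "X = {x \<in> \<Omega>. \<exists>j :: 'd \<Rightarrow> nat. (\<forall>i. j i \<le> m) \<and> x = (\<chi> i. a $ i + real (j i) * (s / real m))}"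
    using grid unfolding grid_discretization_def by blast
  have h: "h > 0" using s by simp
  have r: "r > 0" using \<sigma> h by (metis less_le_trans zero_less_mult_pos)
  define w where "w = z + \<sigma> *\<^sub>R (b - z)"
  have "b \<in> B" using cube[of b] r by simp
  then have "w \<in> B" unfolding w_def using B \<sigma> by (intro convex_contraction) auto
  then have wbox: "a $ i \<le> w $ i" "w $ i \<le> a $ i + s" for i using box B by (auto simp: mem_box_cart)
  \<comment> \<open>Rounding down stays inside the grid: w lies in the bounding box, so the indices
    are between 0 and m.\<close>
  define j where "j = (\<lambda>i. nat \<lfloor>(w $ i - a $ i) / h\<rfloor>)"
  have j: "real (j i) * h \<le> w $ i - a $ i" "w $ i - a $ i < real (j i) * h + h" for i
  proof -
    have "real (j i) = of_int \<lfloor>(w $ i - a $ i) / h\<rfloor>" using wbox[of i] h by (simp add: j_def)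
    then have "real (j i) \<le> (w $ i - a $ i) / h" "(w $ i - a $ i) / h < real (j i) + 1" by linarith+
    then show "real (j i) * h \<le> w $ i - a $ i" "w $ i - a $ i < real (j i) * h + h"
      using h by (simp_all add: field_simps)
  qed
  have jm: "j i \<le> m" for i
  proof -
    have "real (j i) * h \<le> real m * h" using j(1)[of i] wbox(2)[of i] s by simp
    then show ?thesis using h by simp
  qed
  define y where "y = (\<chi> i. a $ i + real (j i) * h)"
  define q where "q = b + (1 / \<sigma>) *\<^sub>R (y - w)"
  have q: "\<bar>q $ i - b $ i\<bar> \<le> r" for i
  proof -
    have "\<bar>y $ i - w $ i\<bar> \<le> \<sigma> * r" using j[of i] \<sigma>(3) by (simp add: y_def)
    then have "\<bar>y $ i - w $ i\<bar> / \<sigma> \<le> r" using \<sigma> by (simp add: field_simps)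
    then show ?thesis using \<sigma> by (simp add: q_def abs_divide)
  qed
  have yq: "y = z + \<sigma> *\<^sub>R (q - z)"
  proof -
    have "\<sigma> *\<^sub>R (q - z) = \<sigma> *\<^sub>R (b - z) + (y - w)" using \<sigma> by (simp add: q_def algebra_simps)
    then show ?thesis by (simp add: w_def)
  qed
  have "y \<in> B" unfolding yq using B \<sigma> cube[OF q] by (intro convex_contraction) auto
  then have "y \<in> X" unfolding Xeq using B jm by (auto simp: y_def s(3))
  then show ?thesis using that q yq by blast
qed

section \<open>Norming grids on a convex body and on a finite union\<close>

lemma convex_body_contains_cube:
  fixes B :: "(real ^ 'd::finite) set"
  assumes "convex_body B"
  obtains b r where "r > 0" "\<And>q. (\<And>i. \<bar>q $ i - b $ i\<bar> \<le> r) \<Longrightarrow> q \<in> B"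
proof -
  obtain b \<rho> where b: "\<rho> > 0" "ball b \<rho> \<subseteq> B"
    using assms unfolding convex_body_def by (meson all_not_in_conv mem_interior)
  show ?thesis
  proof
    show "\<rho> / (2 * real CARD('d)) > 0" using b by simp
    fix q assume q: "\<And>i. \<bar>q $ i - b $ i\<bar> \<le> \<rho> / (2 * real CARD('d))"
    have "dist q b \<le> (\<Sum>i\<in>UNIV. \<bar>q $ i - b $ i\<bar>)" using norm_le_l1_cart[of "q - b"] by (simp add: dist_norm)
    also have "\<dots> \<le> real CARD('d) * (\<rho> / (2 * real CARD('d)))"
      using q by (intro sum_bounded_above) auto
    also have "\<dots> < \<rho>" using b by simp
    finally show "q \<in> B" using b by (auto simp: dist_commute)
  qed
qed

lemma convex_body_norming_grid:
  fixes B :: "(real ^ 'd::finite) set"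
  assumes B: "convex_body B"
  shows "\<exists>K n0. \<forall>n\<ge>n0. \<forall>\<Omega> h X p \<epsilon>. B \<subseteq> \<Omega> \<longrightarrow> grid_discretization \<Omega> h X \<longrightarrow> h \<le> \<kappa> / (real n)\<^sup>2 \<longrightarrow>
    p \<in> total_degree_polys n \<longrightarrow> (\<forall>y\<in>X. \<bar>p y\<bar> \<le> \<epsilon>) \<longrightarrow> (\<forall>x\<in>B. \<bar>p x\<bar> \<le> K * \<epsilon>)"
proof -
  obtain b r where r: "r > 0" and cube: "\<And>q. (\<And>i. \<bar>q $ i - b $ i\<bar> \<le> r) \<Longrightarrow> q \<in> B"
    using convex_body_contains_cube[OF B] by blast
  \<comment> \<open>Half the cube, so that both the reflection of q in b and the doubling of q - b
    stay in the full cube.\<close>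
  define Q where "Q = {q. \<forall>i. \<bar>q $ i - b $ i\<bar> \<le> r / 2}"
  \<comment> \<open>Chosen so that h \<le> \<kappa> / n^2 gives h \<le> (C / n^2) (r / 2). The
    absolute value and the summand 1 make C positive for every real \<kappa>.\<close>
  define C where "C = 2 * \<bar>\<kappa>\<bar> / r + 1"
  have "C * (r / 2) = \<bar>\<kappa>\<bar> + r / 2" using r by (simp add: C_def field_simps)
  then have C: "C > 0" "\<kappa> \<le> C * (r / 2)" using r by (auto simp: C_def add_nonneg_pos)
  have cB: "compact B" "convex B" using B by (auto simp: convex_body_def)
  have bB: "b \<in> B" using cube[of b] r by simp
  have Q: "b - (q - b) \<in> B \<and> b + 2 *\<^sub>R (q - b) \<in> B" if "q \<in> Q" for q
  proof -
    have *: "\<bar>q $ i - b $ i\<bar> \<le> r / 2" for i using that by (simp add: Q_def)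
    have "\<bar>b $ i - q $ i\<bar> \<le> r" for i using *[of i] r by linarith
    moreover have "\<bar>2 * q $ i - 2 * b $ i\<bar> \<le> r" for i using *[of i] by linarith
    ultimately show ?thesis by (auto intro!: cube)
  qed
  obtain K n0 where K: "\<forall>n\<ge>n0. \<forall>X p \<epsilon>. p \<in> total_degree_polys n \<longrightarrow>
    (\<forall>z\<in>B. \<exists>y\<in>X. \<exists>q\<in>Q. y = z + (C / (real n)\<^sup>2) *\<^sub>R (q - z)) \<longrightarrow>
    (\<forall>y\<in>X. \<bar>p y\<bar> \<le> \<epsilon>) \<longrightarrow> (\<forall>x\<in>B. \<bar>p x\<bar> \<le> K * \<epsilon>)"
    using norming_mesh[OF cB bB, of Q C] Q C(1) by blast
  define n1 where "n1 = max n0 (nat \<lceil>C\<rceil> + 1)"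
  have "\<forall>x\<in>B. \<bar>p x\<bar> \<le> K * \<epsilon>"
    if n: "n \<ge> n1" and "B \<subseteq> \<Omega>" "grid_discretization \<Omega> h X" "h \<le> \<kappa> / (real n)\<^sup>2"
      "p \<in> total_degree_polys n" "\<forall>y\<in>X. \<bar>p y\<bar> \<le> \<epsilon>" for n \<Omega> h X p \<epsilon>
  proof -
    have "n \<ge> n0" "real n \<ge> C" "n > 0" using n unfolding n1_def by linarith+
    have "real n * 1 \<le> real n * real n" using \<open>n > 0\<close> by (intro mult_left_mono) auto
    then have n2: "C \<le> (real n)\<^sup>2" using \<open>real n \<ge> C\<close> unfolding power2_eq_square by linarith
    have "\<exists>y\<in>X. \<exists>q\<in>Q. y = z + (C / (real n)\<^sup>2) *\<^sub>R (q - z)" if z: "z \<in> B" for z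
    proof -
      have "\<kappa> / (real n)\<^sup>2 \<le> C * (r / 2) / (real n)\<^sup>2" using C by (intro divide_right_mono) auto
      then have hb: "h \<le> C / (real n)\<^sup>2 * (r / 2)" using \<open>h \<le> \<kappa> / (real n)\<^sup>2\<close> by simp
      have cube2: "q \<in> B" if "\<And>i. \<bar>q $ i - b $ i\<bar> \<le> r / 2" for q
        by (rule cube) (use r in \<open>auto intro!: order_trans[OF that]\<close>)
      obtain y q where "y \<in> X" "\<And>i. \<bar>q $ i - b $ i\<bar> \<le> r / 2" "y = z + (C / (real n)\<^sup>2) *\<^sub>R (q - z)"
        by (rule grid_point_towards_cube[OF \<open>grid_discretization \<Omega> h X\<close> cB(2) \<open>B \<subseteq> \<Omega>\<close> z cube2 _ _ hb])
          (use C n2 \<open>n > 0\<close> in auto)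
      then show ?thesis unfolding Q_def by blast
    qed
    then show ?thesis using K \<open>n \<ge> n0\<close> that by blast
  qed
  then show ?thesis by (intro exI[of _ K] exI[of _ n1]) blast
qed

lemma finite_union_norming_grid:
  fixes F :: "(real ^ 'd::finite) set set"
  assumes F: "finite F" "\<And>B. B \<in> F \<Longrightarrow> convex_body B"
  obtains K n0 where "K \<ge> 0"
    "\<And>n h X p \<epsilon>. \<lbrakk>n \<ge> n0; grid_discretization (\<Union>F) h X; h \<le> \<kappa> / (real n)\<^sup>2; p \<in> total_degree_polys n;
       \<And>y. y \<in> X \<Longrightarrow> \<bar>p y\<bar> \<le> \<epsilon>; \<epsilon> \<ge> 0\<rbrakk> \<Longrightarrow> \<forall>x\<in>\<Union>F. \<bar>p x\<bar> \<le> K * \<epsilon>"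
proof -
  have "\<forall>B\<in>F. \<exists>K n0. \<forall>n\<ge>n0. \<forall>\<Omega> h X p \<epsilon>. B \<subseteq> \<Omega> \<longrightarrow> grid_discretization \<Omega> h X \<longrightarrow> h \<le> \<kappa> / (real n)\<^sup>2 \<longrightarrow>
    p \<in> total_degree_polys n \<longrightarrow> (\<forall>y\<in>X. \<bar>p y\<bar> \<le> \<epsilon>) \<longrightarrow> (\<forall>x\<in>B. \<bar>p x\<bar> \<le> K * \<epsilon>)"
    using F(2) convex_body_norming_grid by blast
  then obtain K n0 where K: "\<forall>B\<in>F. \<forall>n\<ge>n0 B. \<forall>\<Omega> h X p \<epsilon>. B \<subseteq> \<Omega> \<longrightarrow> grid_discretization \<Omega> h X \<longrightarrow> h \<le> \<kappa> / (real n)\<^sup>2 \<longrightarrow>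
    p \<in> total_degree_polys n \<longrightarrow> (\<forall>y\<in>X. \<bar>p y\<bar> \<le> \<epsilon>) \<longrightarrow> (\<forall>x\<in>B. \<bar>p x\<bar> \<le> K B * \<epsilon>)"
    by (elim bchoice[THEN exE] bchoice) (metis (no_types, lifting))
  show ?thesis
  proof
    show "(\<Sum>B\<in>F. \<bar>K B\<bar>) \<ge> 0" by (simp add: sum_nonneg)
    fix n h X p \<epsilon>
    assume n: "n \<ge> (\<Sum>B\<in>F. n0 B)" and *: "grid_discretization (\<Union>F) h X" "h \<le> \<kappa> / (real n)\<^sup>2" "p \<in> total_degree_polys n"
       "\<And>y. y \<in> X \<Longrightarrow> \<bar>p y\<bar> \<le> \<epsilon>" "\<epsilon> \<ge> 0"
    show "\<forall>x\<in>\<Union>F. \<bar>p x\<bar> \<le> (\<Sum>B\<in>F. \<bar>K B\<bar>) * \<epsilon>"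
    proof
      fix x assume "x \<in> \<Union>F"
      then obtain B where B: "B \<in> F" "x \<in> B" by blast
      have "n0 B \<le> (\<Sum>B\<in>F. n0 B)" using F B by (intro member_le_sum) auto
      then have "\<bar>p x\<bar> \<le> K B * \<epsilon>" using K B n * by (meson Union_upper le_trans)
      also have "\<dots> \<le> (\<Sum>B\<in>F. \<bar>K B\<bar>) * \<epsilon>"
        using F B * member_le_sum[of B F "\<lambda>B. \<bar>K B\<bar>"] by (intro mult_right_mono) auto
      finally show "\<bar>p x\<bar> \<le> (\<Sum>B\<in>F. \<bar>K B\<bar>) * \<epsilon>" .
    qed
  qed
qed

lemma total_degree_dim_bigtheta:
  assumes "d > 0"
  shows "(\<lambda>n. real (total_degree_dim d n)) \<in> \<Theta>(\<lambda>n. real n ^ d)"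
proof (rule bigthetaI')
  show "(1 / real d ^ d) > 0" "(2 ^ d :: real) > 0" using assms by auto
  show "\<forall>\<^sub>F n in sequentially. norm (real (total_degree_dim d n)) \<ge> 1 / real d ^ d * norm (real n ^ d) \<and>
      norm (real (total_degree_dim d n)) \<le> 2 ^ d * norm (real n ^ d)"
    using eventually_ge_at_top[of d]
  proof eventually_elim
    case (elim n)
    have eq: "total_degree_dim d n = (n + d) choose d"
      unfolding total_degree_dim_def by (subst binomial_symmetric) auto
    have "(real n / real d) ^ d \<le> (real (n + d) / real d) ^ d"
      using assms by (intro power_mono divide_right_mono) auto
    also have "\<dots> \<le> real ((n + d) choose d)" by (rule binomial_ge_n_over_k_pow_k) simp
    finally have lower: "1 / real d ^ d * real n ^ d \<le> real (total_degree_dim d n)"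
      by (simp add: eq power_divide)
    have "(n + d) choose d \<le> (n + d) ^ d" by (rule binomial_le_pow) simp
    also have "\<dots> \<le> (2 * n) ^ d" using elim by (intro power_mono) auto
    finally have "real ((n + d) choose d) \<le> real ((2 * n) ^ d)" by (simp only: of_nat_le_iff)
    with lower show ?case by (simp add: eq power_mult_distrib)
  qed
qed

section \<open>Least squares\<close>

lemma least_squares_deviation:
  assumes L: "least_squares_approx n X f q" and X: "finite X" and p: "p \<in> total_degree_polys n"
    and \<eta>: "\<And>x. x \<in> X \<Longrightarrow> \<bar>f x - p x\<bar> \<le> \<eta>" "\<eta> \<ge> 0" and y: "y \<in> X"
  shows "\<bar>f y - q y\<bar> \<le> sqrt (real (card X)) * \<eta>"
proof -
  have "\<bar>f y - q y\<bar>\<^sup>2 \<le> (\<Sum>x\<in>X. \<bar>f x - q x\<bar>\<^sup>2)" using X y by (intro member_le_sum) auto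
  also have "\<dots> \<le> (\<Sum>x\<in>X. \<bar>f x - p x\<bar>\<^sup>2)"
    using L p unfolding least_squares_approx_def is_arg_min_def by (meson not_le)
  also have "\<dots> \<le> (\<Sum>x\<in>X. \<eta>\<^sup>2)" using \<eta> by (intro sum_mono power_mono) auto
  also have "\<dots> = (sqrt (real (card X)) * \<eta>)\<^sup>2" by (simp add: power_mult_distrib)
  finally show ?thesis using \<eta>(2) by (simp add: abs_le_square_iff[symmetric] abs_mult)
qed

theorem least_squares_sup_error:
  fixes F :: "(real ^ 'd::finite) set set" and N :: "nat \<Rightarrow> real"
  assumes F: "finite F" "F \<noteq> {}" "\<And>B. B \<in> F \<Longrightarrow> convex_body B"
    and f: "continuously_differentiable_to_order k (\<Union>F) f"
    and X: "\<And>n. n \<ge> 1 \<Longrightarrow> equispaced_discretization (\<Union>F) (X n)" "\<And>n. n \<ge> 1 \<Longrightarrow> mesh_condition c n (\<Union>F) (X n)"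
    and N: "(\<lambda>n. real (card (X n))) \<in> O(\<lambda>n. (N n)\<^sup>2)" "\<And>n. N n \<ge> 0"
    and L: "\<And>n. n \<ge> 1 \<Longrightarrow> least_squares_approx n (X n) f (L n)"
  shows "\<exists>C. \<forall>\<^sub>F n in sequentially. sup_norm_on (\<Union>F) (\<lambda>x. f x - L n x) \<le> (1 + N n) * (C * real n powr (- real k))"
proof -
  define \<Omega> where "\<Omega> = \<Union>F"
  \<comment> \<open>The mesh radius is \<kappa> / n^2. \<open>grid_spacing_le\<close> converts it
    into a spacing of at most 4 \<kappa> / n^2, hence the constant 4 \<kappa> in the norming
    estimate.\<close>
  define \<kappa> where "\<kappa> = c / markov_factor \<Omega>"
  have cpt: "compact \<Omega>" unfolding \<Omega>_def using F by (intro compact_Union) (auto simp: convex_body_def)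
  obtain B where B: "B \<in> F" using F by blast
  obtain b r where r: "r > 0" and "\<And>q. (\<And>i. \<bar>q $ i - b $ i\<bar> \<le> r) \<Longrightarrow> q \<in> B"
    using convex_body_contains_cube[OF F(3)[OF B]] by blast
  then have cube: "\<And>q. (\<And>i. \<bar>q $ i - b $ i\<bar> \<le> r) \<Longrightarrow> q \<in> \<Omega>" using B by (auto simp: \<Omega>_def)
  then have b: "b \<in> \<Omega>" using r by simp
  obtain K n1 where K: "K \<ge> 0" and norming:
    "\<And>n h X p \<epsilon>. \<lbrakk>n \<ge> n1; grid_discretization \<Omega> h X; h \<le> 4 * \<kappa> / (real n)\<^sup>2; p \<in> total_degree_polys n;
       \<And>y. y \<in> X \<Longrightarrow> \<bar>p y\<bar> \<le> \<epsilon>; \<epsilon> \<ge> 0\<rbrakk> \<Longrightarrow> \<forall>x\<in>\<Omega>. \<bar>p x\<bar> \<le> K * \<epsilon>"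
    using finite_union_norming_grid[OF F(1,3), of "4 * \<kappa>"] unfolding \<Omega>_def by metis
  obtain C n2 where jackson: "\<And>n. n \<ge> n2 \<Longrightarrow> \<exists>p \<in> total_degree_polys n. \<forall>x\<in>\<Omega>. \<bar>f x - p x\<bar> \<le> C / real n ^ k"
    using jackson_total_degree[OF cpt, of k f] f unfolding \<Omega>_def by blast
  obtain M where M: "M > 0" "\<forall>\<^sub>F n in sequentially. norm (real (card (X n))) \<le> M * norm ((N n)\<^sup>2)"
    using landau_o.bigE[OF N(1)] by blast
  have small: "\<forall>\<^sub>F n in sequentially. \<kappa> / (real n)\<^sup>2 < r / 2"
  proof (rule order_tendstoD)
    show "(\<lambda>n. \<kappa> / (real n)\<^sup>2) \<longlonglongrightarrow> 0"
      by (intro tendsto_divide_0[OF tendsto_const] filterlim_at_top_imp_at_infinity filterlim_pow_at_top filterlim_real_sequentially) simp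
  qed (use r in simp)
  have "\<forall>\<^sub>F n in sequentially. sup_norm_on \<Omega> (\<lambda>x. f x - L n x) \<le> (1 + N n) * ((\<bar>C\<bar> * (1 + K + K * sqrt M)) * real n powr (- real k))"
    using M(2) small eventually_ge_at_top[of n1] eventually_ge_at_top[of n2] eventually_ge_at_top[of 1]
  proof eventually_elim
    case (elim n)
    define \<eta> where "\<eta> = \<bar>C\<bar> / real n ^ k"
    have \<eta>: "\<eta> \<ge> 0" by (simp add: \<eta>_def)
    obtain p where p: "p \<in> total_degree_polys n" "\<And>x. x \<in> \<Omega> \<Longrightarrow> \<bar>f x - p x\<bar> \<le> C / real n ^ k"
      using jackson[of n] elim by blast
    have "C / real n ^ k \<le> \<eta>" unfolding \<eta>_def by (intro divide_right_mono) auto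
    then have p\<eta>: "\<bar>f x - p x\<bar> \<le> \<eta>" if "x \<in> \<Omega>" for x using p(2)[OF that] by linarith
    obtain h where grid: "grid_discretization \<Omega> h (X n)"
      using X(1)[of n] elim unfolding equispaced_iff_grid \<Omega>_def by blast
    have X\<Omega>: "X n \<subseteq> \<Omega>" using grid unfolding grid_discretization_def by blast
    have mesh: "X n \<noteq> {}" "\<And>x. x \<in> \<Omega> \<Longrightarrow> (INF y\<in>X n. infnorm (y - x)) \<le> \<kappa> / (real n)\<^sup>2"
      using X(2)[of n] elim unfolding mesh_condition_def \<kappa>_def \<Omega>_def by auto
    have "h \<le> 4 * (\<kappa> / (real n)\<^sup>2)" by (rule grid_spacing_le[OF grid cube r mesh]) (use elim in auto)
    then have h: "h \<le> 4 * \<kappa> / (real n)\<^sup>2" by simp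
    have Ln: "L n \<in> total_degree_polys n"
      using L[of n] elim unfolding least_squares_approx_def is_arg_min_def by blast
    have "sqrt (real (card (X n))) \<le> sqrt (M * (N n)\<^sup>2)" using elim by simp
    also have "\<dots> = sqrt M * N n" using N(2)[of n] by (simp add: real_sqrt_mult)
    finally have card: "sqrt (real (card (X n))) \<le> sqrt M * N n" .
    \<comment> \<open>Norming applies to polynomials, so the estimate passes through p - L n: on the
      grid, f is compared with L n by least squares and with p by approximation; off the grid only
      the latter comparison is needed.\<close>
    have "\<bar>p y - L n y\<bar> \<le> (1 + sqrt M * N n) * \<eta>" if y: "y \<in> X n" for y
    proof -
      have "\<bar>f y - L n y\<bar> \<le> sqrt (real (card (X n))) * \<eta>"
        by (rule least_squares_deviation[OF L finite_grid[OF grid] p(1) _ \<eta> y]) (use elim p\<eta> X\<Omega> in auto)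
      also have "\<dots> \<le> sqrt M * N n * \<eta>" using card \<eta> by (rule mult_right_mono)
      finally show ?thesis using p\<eta>[of y] X\<Omega> y by (simp add: distrib_right subset_iff)
    qed
    moreover have "(1 + sqrt M * N n) * \<eta> \<ge> 0" using M(1) N(2)[of n] \<eta> by simp
    ultimately have "\<forall>x\<in>\<Omega>. \<bar>p x - L n x\<bar> \<le> K * ((1 + sqrt M * N n) * \<eta>)"
      by (intro norming[OF _ grid h diff_total_degree[OF p(1) Ln]]) (use elim in auto)
    then have err: "\<bar>f x - L n x\<bar> \<le> \<eta> + K * ((1 + sqrt M * N n) * \<eta>)" if "x \<in> \<Omega>" for x
      using p\<eta>[OF that] that by force
    have "sup_norm_on \<Omega> (\<lambda>x. f x - L n x) \<le> \<eta> + K * ((1 + sqrt M * N n) * \<eta>)"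
      unfolding sup_norm_on_def using b err by (intro cSUP_least) auto
    also have "\<dots> = (1 + K + K * sqrt M * N n) * \<eta>" by (simp add: algebra_simps)
    also have "\<dots> \<le> ((1 + N n) * (1 + K + K * sqrt M)) * \<eta>"
    proof (rule mult_right_mono[OF _ \<eta>])
      have "(1 + N n) * (1 + K + K * sqrt M) = (1 + K + K * sqrt M * N n) + (K * sqrt M + N n + N n * K)"
        by (simp add: algebra_simps)
      moreover have "K * sqrt M + N n + N n * K \<ge> 0" using K M(1) N(2)[of n] by simp
      ultimately show "1 + K + K * sqrt M * N n \<le> (1 + N n) * (1 + K + K * sqrt M)" by linarith
    qed
    also have "\<eta> = \<bar>C\<bar> * real n powr (- real k)"
      using \<open>1 \<le> n\<close> by (simp add: \<eta>_def powr_minus powr_realpow divide_inverse)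
    finally show ?case by (simp add: mult_ac)
  qed
  then show ?thesis unfolding \<Omega>_def by blast
qed

theorem theorem4p7:
  fixes \<Omega> :: "(real ^ 'd::finite) set"
    and f :: "real ^ 'd \<Rightarrow> real"
    and k :: nat
    and c :: real
    and X :: "nat \<Rightarrow> (real ^ 'd) set"
    and L :: "nat \<Rightarrow> real ^ 'd \<Rightarrow> real"
  defines "N \<equiv> \<lambda>n. real (total_degree_dim CARD('d) n)"
  assumes "CARD('d) > 1"
    and "convex_body \<Omega> \<or> finite_union_of_convex_bodies \<Omega>"
    and "continuously_differentiable_to_order k \<Omega> f"
    and "0 < c" and "c \<le> 1 / (2 * sqrt (real CARD('d)))"
    and "\<And>n. n \<ge> 1 \<Longrightarrow> equispaced_discretization \<Omega> (X n)"
    and "\<And>n. n \<ge> 1 \<Longrightarrow> mesh_condition c n \<Omega> (X n)"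
    and "(\<lambda>n. real (card (X n))) \<in> O(\<lambda>n. (N n)\<^sup>2)"
    and "\<And>n. n \<ge> 1 \<Longrightarrow> least_squares_approx n (X n) f (L n)"
  shows "\<exists>A B :: nat \<Rightarrow> real.
      A \<in> O(N) \<and> B \<in> O(\<lambda>n. real n powr (- real k)) \<and>
      (\<forall>n\<ge>1. sup_norm_on \<Omega> (\<lambda>x. f x - L n x) \<le> (1 + A n) * B n) \<and>
      (\<lambda>n. (1 + A n) * B n) \<in> O(\<lambda>n. real n powr (real CARD('d) - real k)) \<and>
      O(\<lambda>n. real n powr (real CARD('d) - real k))
        = O(\<lambda>n. N n powr (1 - real k / real CARD('d)))"
proof -
  let ?d = "CARD('d)"
  obtain F where F: "finite F" "F \<noteq> {}" "\<And>B. B \<in> F \<Longrightarrow> convex_body B" "\<Omega> = \<Union>F"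
  proof (cases "convex_body \<Omega>")
    case True
    then show ?thesis using that[of "{\<Omega>}"] by simp
  next
    case False
    then show ?thesis using assms(3) that unfolding finite_union_of_convex_bodies_def by metis
  qed
  have N0: "N n \<ge> 0" for n by (simp add: N_def)
  obtain C where C: "\<forall>\<^sub>F n in sequentially. sup_norm_on \<Omega> (\<lambda>x. f x - L n x) \<le> (1 + N n) * (C * real n powr (- real k))"
    using least_squares_sup_error[OF F(1-3), of k f X c N L] assms(4,7-10) N0 unfolding F(4) by blast
  then obtain n0 where n0: "\<And>n. n \<ge> n0 \<Longrightarrow> sup_norm_on \<Omega> (\<lambda>x. f x - L n x) \<le> (1 + N n) * (C * real n powr (- real k))"
    unfolding eventually_at_top_linorder by blast
  \<comment> \<open>The constant C serves large n only, whereas the inequality is claimed for every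
    n \<ge> 1. Below n0 the error itself is taken: finitely many values do not affect the O class,
    and 1 + N n \<ge> 1.\<close>
  define B where "B = (\<lambda>n. if n \<ge> n0 then C * real n powr (- real k) else \<bar>sup_norm_on \<Omega> (\<lambda>x. f x - L n x)\<bar>)"
  have "\<forall>\<^sub>F n in sequentially. B n = C * real n powr (- real k)"
    using eventually_ge_at_top[of n0] by eventually_elim (simp add: B_def)
  then have B: "B \<in> O(\<lambda>n. real n powr (- real k))"
    by (subst landau_o.big.in_cong) auto
  have bound: "sup_norm_on \<Omega> (\<lambda>x. f x - L n x) \<le> (1 + N n) * B n" for n
  proof (cases "n \<ge> n0")
    case False
    have "\<bar>sup_norm_on \<Omega> (\<lambda>x. f x - L n x)\<bar> \<le> (1 + N n) * \<bar>sup_norm_on \<Omega> (\<lambda>x. f x - L n x)\<bar>"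
      using N0[of n] by (simp add: distrib_right)
    then show ?thesis using False by (simp add: B_def)
  qed (simp add: B_def n0)
  have theta: "N \<in> \<Theta>(\<lambda>n. real n powr real ?d)"
  proof -
    have "\<forall>\<^sub>F n in sequentially. real n ^ ?d = real n powr real ?d"
      using eventually_gt_at_top[of 0] by eventually_elim (simp add: powr_realpow)
    then have "\<Theta>(\<lambda>n. real n ^ ?d) = \<Theta>(\<lambda>n. real n powr real ?d)" by (rule landau_theta.cong)
    then show ?thesis unfolding N_def using total_degree_dim_bigtheta[of ?d] by simp
  qed
  have "(\<lambda>n. 1) \<in> O(\<lambda>n. real n powr real ?d)"
    by (rule landau_o.bigI[of 1]) (auto intro!: eventually_mono[OF eventually_ge_at_top[of 1]] ge_one_powr_ge_zero)
  moreover have "N \<in> O(\<lambda>n. real n powr real ?d)" using theta by (rule bigthetaD1)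
  ultimately have "(\<lambda>n. (1 + N n) * B n) \<in> O(\<lambda>n. real n powr real ?d * real n powr (- real k))"
    by (intro landau_o.big.mult B sum_in_bigo)
  then have "(\<lambda>n. (1 + N n) * B n) \<in> O(\<lambda>n. real n powr (real ?d - real k))"
    by (simp flip: powr_add)
  moreover have "O(\<lambda>n. real n powr (real ?d - real k)) = O(\<lambda>n. N n powr (1 - real k / real ?d))"
  proof -
    \<comment> \<open>The exponent is negative for k > d, with d the dimension, so an upper bound on
      N alone would not do; the two-sided bound may be raised to powers of either sign.\<close>
    have "(\<lambda>n. N n powr (1 - real k / real ?d)) \<in> \<Theta>(\<lambda>n. (real n powr real ?d) powr (1 - real k / real ?d))"
      using bigtheta_powr[OF theta, of "1 - real k / real ?d"] N0 by simp
    also have "(\<lambda>n. (real n powr real ?d) powr (1 - real k / real ?d)) = (\<lambda>n. real n powr (real ?d - real k))"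
      by (simp add: powr_powr right_diff_distrib)
    finally show ?thesis by (rule landau_o.big.cong_bigtheta[symmetric])
  qed
  ultimately show ?thesis using B bound landau_o.big_refl[of N] by blast
qed

end
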